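(* Let $n$ and $l$ be integers with $1\le l\le n-2$ (so $n\geq 3$). Then there exist $R_\theta$-invariant $h$-convex bodies $K,L$ in $\mathbb{R}^{2n}\cong\mathbb{C}^n$ such that for every complex linear subspace $H\subset\mathbb{C}^n$ of complex dimension $n-l$ $$\mathrm{HVol}_{2n-2l}(K\cap H)\le \mathrm{HVol}_{2n-2l}(L\cap H),$$ but $$\mathrm{HVol}_{2n}(K)>\mathrm{HVol}_{2n}(L).$$
   Context: Identify $\mathbb{C}^n$ with $\mathbb{R}^{2n}$ via $(\xi_{11}+i\xi_{12},\dots,\xi_{n1}+i\xi_{n2})\mapsto(\xi_{11},\xi_{12},\dots,\xi_{n1},\xi_{n2})$. The complex hyperbolic space $\mathbb{H}^n_{\mathbb{C}}$ is modelled on the open unit ball $B^n=\{z\in\mathbb{C}^n: |z|<1\}$ with the Bergman metric. Bodies are compact sets containing the origin as an interior point. For a body $K$ that is star-shaped about the origin, $\|x\|_K=\min\{a\ge 0: x\in aK\}$ is its Minkowski functional, so $\|x\|_K^{-1}$, $x\in S^{2n-1}$, is the Euclidean distance from the origin to the boundary of $K$ in the direction $x$. A body $K\subset\mathbb{R}^{2n}$ is $R_\theta$-invariant if for every $\theta\in[0,2\pi]$ and every $\xi\in\mathbb{R}^{2n}$ one has $\|\xi\|_K=\|(R_\theta(\xi_{11},\xi_{12}),\dots,R_\theta(\xi_{n1},\xi_{n2}))\|_K$, where $R_\theta$ is the counterclockwise rotation of $\mathbb{R}^2$ by the angle $\theta$; equivalently, $K$ is invariant under $z\mapsto e^{i\theta}z$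 on $\mathbb{C}^n$. Geodesic segments: for distinct $x,y\in B^n$ let $\ell$ be the unique affine complex line through $x$ and $y$. Then $\ell\cap B^n$ is a round open disc, say of radius $R$, on which the Bergman metric restricts to the Poincaré metric $\frac{4R^2\,dz\,d\bar z}{(R^2-r^2)^2}$, where $r$ is the Euclidean distance to the center of the disc. The geodesic segment joining $x$ and $y$ is the Poincaré geodesic segment joining them in this disc (an arc of a circle in $\ell$ orthogonal to the boundary circle of the disc, or a segment of a diameter of the disc). A body contained in $B^n$ is $h$-convex if it contains, with any two of its points, the geodesic segment joining them. Such a body is star-shaped about the origin. Hyperbolic volume: for a complex linear subspace $H\subset\mathbb{C}^n$ of complex dimension $m$, $1\le m\le n$, and an $h$-convex body $K$, $$\mathrm{HVol}_{2m}(K\cap H)=8^{m}\int_{S^{2n-1}\cap H}\int_0^{\|x\|_K^{-1}}\frac{r^{2m-1}}{(1-r^2)^{m+1}}\,dr\,d\sigma(x),$$ where $\sigma$ is the surface measure on the unit sphere $S^{2n-1}\cap H$ of $H$. In particular, for $H=\mathbb{C}^n$ this is $\mathrm{HVol}_{2n}(K)$. *)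

theory Defs
  imports "HOL-Analysis.Analysis"
begin

text \<open>
  Complex \<open>n\<close>-space is \<^typ>\<open>complex ^ 'n\<close> with \<open>n = CARD('n)\<close>. Its norm and (real) inner product are
  the Euclidean ones of real \<open>2n\<close>-space. Complex linear notions are \<^const>\<open>vec.subspace\<close>,
  \<^const>\<open>vec.dim\<close> and \<open>*s\<close>; the unprefixed \<^const>\<open>span\<close> and \<^const>\<open>dim\<close> are the real ones.
\<close>

section \<open>Bodies and the Minkowski functional\<close>

definition body :: "(complex ^ 'n) set \<Rightarrow> bool" where
  "body K \<longleftrightarrow> compact K \<and> 0 \<in> interior K"

text \<open>The minimum exists for every body \<open>K\<close>.\<close>

definition minkowski_functional :: "(complex ^ 'n) set \<Rightarrow> complex ^ 'n \<Rightarrow> real" where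
  "minkowski_functional K x = (LEAST a. 0 \<le> a \<and> x \<in> (\<lambda>y. a *\<^sub>R y) ` K)"

text \<open>Rotating every coordinate by the angle \<open>\<theta>\<close> is scalar multiplication by \<^term>\<open>cis \<theta>\<close>.\<close>

definition R_theta_invariant :: "(complex ^ 'n) set \<Rightarrow> bool" where
  "R_theta_invariant K \<longleftrightarrow>
     (\<forall>\<theta>\<in>{0..2 * pi}. \<forall>\<xi>. minkowski_functional K \<xi> = minkowski_functional K (cis \<theta> *s \<xi>))"

section \<open>Geodesic segments and h-convexity\<close>

definition complex_line :: "complex ^ 'n \<Rightarrow> complex ^ 'n \<Rightarrow> (complex ^ 'n) set" where
  "complex_line x y = range (\<lambda>t. x + t *s (y - x))"

text \<open>The intersection of the complex line \<open>S\<close> with the unit ball is the disc of centre \<open>c\<close> and radius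
  \<open>R\<close> in \<open>S\<close>. For a line meeting the ball this determines \<open>c\<close> and \<open>R\<close>.\<close>

definition is_ball_section :: "(complex ^ 'n) set \<Rightarrow> complex ^ 'n \<Rightarrow> real \<Rightarrow> bool" where
  "is_ball_section S c R \<longleftrightarrow> c \<in> S \<and> R > 0 \<and> S \<inter> ball 0 1 = S \<inter> ball c R"

text \<open>Two coplanar circles are orthogonal iff the squared distance of the centres is the sum of the
  squared radii (the radii to a common point are then perpendicular).\<close>

definition orthogonal_circles :: "complex ^ 'n \<Rightarrow> real \<Rightarrow> complex ^ 'n \<Rightarrow> real \<Rightarrow> bool" where
  "orthogonal_circles p \<rho> c R \<longleftrightarrow> \<rho> > 0 \<and> R > 0 \<and> (dist p c)\<^sup>2 = \<rho>\<^sup>2 + R\<^sup>2"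

text \<open>The arc between \<open>x\<close> and \<open>y\<close> cut out by the convex cone at the centre \<open>p\<close> spanned by \<open>x - p\<close> and
  \<open>y - p\<close>, i.e. the minor arc.\<close>

definition minor_arc :: "complex ^ 'n \<Rightarrow> real \<Rightarrow> complex ^ 'n \<Rightarrow> complex ^ 'n \<Rightarrow> (complex ^ 'n) set" where
  "minor_arc p \<rho> x y =
     {z \<in> sphere p \<rho>. \<exists>a\<ge>0. \<exists>b\<ge>0. z - p = a *\<^sub>R (x - p) + b *\<^sub>R (y - p)}"

text \<open>
  The geodesic segment of the Poincar\'e metric of the disc with centre \<open>c\<close> and radius \<open>R\<close> in the
  complex line through \<open>x\<close> and \<open>y\<close>: a Euclidean segment if the real line through \<open>x\<close> and \<open>y\<close> contains
  \<open>c\<close> (a diameter), and otherwise an arc of the unique circle through \<open>x\<close> and \<open>y\<close> orthogonal to the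
  boundary circle. The part of that circle inside the disc is shorter than a semicircle, so the arc
  in the disc from \<open>x\<close> to \<open>y\<close> is the minor one. The two cases exclude each other for distinct points
  of the ball.
\<close>

definition geodesic_segment :: "complex ^ 'n \<Rightarrow> complex ^ 'n \<Rightarrow> (complex ^ 'n) set" where
  "geodesic_segment x y =
     {z. \<exists>c R. is_ball_section (complex_line x y) c R \<and>
        (c \<in> affine hull {x, y} \<and> z \<in> closed_segment x y \<or>
         (\<exists>p\<in>complex_line x y. \<exists>\<rho>. orthogonal_circles p \<rho> c R \<and>
            x \<in> sphere p \<rho> \<and> y \<in> sphere p \<rho> \<and> z \<in> minor_arc p \<rho> x y))}"

definition h_convex :: "(complex ^ 'n) set \<Rightarrow> bool" where
  "h_convex K \<longleftrightarrow>
     K \<subseteq> ball 0 1 \<and> (\<forall>x\<in>K. \<forall>y\<in>K. x \<noteq> y \<longrightarrow> geodesic_segment x y \<subseteq> K)"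

section \<open>Hyperbolic volume of complex linear sections\<close>

definition is_orthonormal_basis :: "(complex ^ 'n) set \<Rightarrow> (complex ^ 'n) set \<Rightarrow> bool" where
  "is_orthonormal_basis H B \<longleftrightarrow>
     pairwise orthogonal B \<and> (\<forall>b\<in>B. norm b = 1) \<and> span B = H"

text \<open>Lebesgue measure of a linear subspace \<open>H\<close>, as a Borel measure on the whole space concentrated on
  \<open>H\<close>; compare \<open>lborel_def\<close>. By rotation invariance it does not depend on the chosen real
  orthonormal basis.\<close>

definition lborel_subspace :: "(complex ^ 'n) set \<Rightarrow> (complex ^ 'n) measure" where
  "lborel_subspace H =
     (let B = (SOME B. is_orthonormal_basis H B)
      in distr (\<Pi>\<^sub>M b\<in>B. (lborel :: real measure)) borel (\<lambda>f. \<Sum>b\<in>B. f b *\<^sub>R b))"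

text \<open>Surface measure on the unit sphere of \<open>H\<close>: the measure of \<open>A\<close> is \<^term>\<open>dim H\<close> times the Lebesgue
  measure of the cone of all \<open>x\<close> in the unit ball of \<open>H\<close> with \<^term>\<open>sgn x\<close> (that is,
  \<open>x / norm x\<close>) in \<open>A\<close>. It is again a Borel measure on the whole space, concentrated on
  \<^term>\<open>sphere 0 1 \<inter> H\<close>.\<close>

definition sphere_measure :: "(complex ^ 'n) set \<Rightarrow> (complex ^ 'n) measure" where
  "sphere_measure H =
     distr (density (lborel_subspace H) (\<lambda>x. of_nat (dim H) * indicator (cball 0 1) x)) borel sgn"

text \<open>The hyperbolic volume of \<open>K \<inter> H\<close>, in the real dimension of \<open>H\<close>.\<close>

definition hvol :: "(complex ^ 'n) set \<Rightarrow> (complex ^ 'n) set \<Rightarrow> real" where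
  "hvol H K =
     (let m = vec.dim H
      in 8 ^ m * (LINT x : sphere 0 1 \<inter> H | sphere_measure H.
           (LBINT r = 0..1 / minkowski_functional K x. r ^ (2 * m - 1) / (1 - r\<^sup>2) ^ (m + 1))))"

end

theory Submission imports Defs begin

text \<open>
  For a body with radial function \<open>\<rho>\<close> put \<open>u = \<rho>\<^sup>2 / (1 - \<rho>\<^sup>2)\<close>. The radial integral in the volume of
  an \<open>m\<close>-dimensional section is \<open>u ^ m / (2 m)\<close>, so the question becomes the Euclidean one for \<open>u\<close>,
  except that h-convexity of the body is weaker than convexity. Tubes around a complex line through
  the origin are strictly h-convex, and bodies of revolution close to them leave room for a
  counterexample.

  For a body depending only on \<open>|z|\<close> and \<open>v = |z\<^sub>i|\<^sup>2 / |z|\<^sup>2\<close> write \<open>t = 1 / (1 - v)\<close> and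
  \<open>u = t / \<omega>(t)\<close>. Tubes are the constant \<open>\<omega>\<close>, and h-convexity follows if \<open>\<omega>\<close> is convex and
  decreasing with small slope. If \<open>s\<close> is the squared length of the projection of the \<open>i\<close>-th axis to
  \<open>H\<close>, the volume of the section by \<open>H\<close> is, up to constants, the integral of
  \<open>\<omega>(t) ^ (- m) (1 - (1 - s) t) ^ (m - 2)\<close>, and the total volume is the integral of
  \<open>\<omega>(t) ^ (- n)\<close>. Take \<open>\<omega> ^ (- m)\<close> proportional to \<open>1 - \<epsilon> exp (- t)\<close> for \<open>L\<close> and to
  \<open>1 - \<epsilon> (exp (- t) + \<delta> g(t))\<close> for \<open>K\<close>, where \<open>g\<close> is the derivative of order \<open>m - 1\<close> of a
  nonnegative bump function \<open>G\<close>. Integrating by parts, every section of \<open>L\<close> exceeds that of \<open>K\<close> by a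
  nonnegative multiple of a value of \<open>G\<close>. The volume of \<open>K\<close> exceeds that of \<open>L\<close> by at least a
  positive multiple of the integral of \<open>- g(t) (1 - \<epsilon> exp (- t)) ^ (l / m)\<close>, which for small \<open>\<epsilon>\<close> has
  the sign of the integral of \<open>g(t) exp (- t)\<close>, and that equals the integral of \<open>G(t) exp (- t)\<close>.
\<close>

section \<open>Geodesic convexity of quadrics\<close>

lemma norm_complex_smult: "norm (a *s (z :: complex ^ 'n)) = cmod a * norm z"
  by (simp add: norm_vec_def norm_mult L2_set_right_distrib)

lemma scaleR_eq_smult: "r *\<^sub>R (z :: complex ^ 'n) = complex_of_real r *s z"
  by (auto simp: vec_eq_iff complex_eq_iff)

text \<open>Along a real ray from \<open>c\<close> inside \<open>S\<close>, leaving the disc and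
  leaving the unit ball happen at the same parameter \<open>R\<close>, so by continuity the ray
  meets the unit sphere there.\<close>

lemma ball_section_boundary:
  fixes c d :: "complex ^ 'n"
  assumes "is_ball_section S c R" and d: "norm d = 1" "\<And>\<tau>::real. c + \<tau> *\<^sub>R d \<in> S"
  shows "norm (c + R *\<^sub>R d) = 1"
proof -
  have R: "R > 0" and S: "S \<inter> ball 0 1 = S \<inter> ball c R"
    using assms(1) by (auto simp: is_ball_section_def)
  have iff: "norm (c + \<tau> *\<^sub>R d) < 1 \<longleftrightarrow> \<bar>\<tau>\<bar> < R" for \<tau>
  proof -
    have "c + \<tau> *\<^sub>R d \<in> S \<inter> ball 0 1 \<longleftrightarrow> c + \<tau> *\<^sub>R d \<in> S \<inter> ball c R" using S by simp
    moreover have "dist c (c + \<tau> *\<^sub>R d) = \<bar>\<tau>\<bar>" using d(1) by (simp add: dist_norm)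
    ultimately show ?thesis using d(2) by simp
  qed
  have "((\<lambda>\<tau>. norm (c + \<tau> *\<^sub>R d)) \<longlongrightarrow> norm (c + R *\<^sub>R d)) (at_left R)"
    by (intro tendsto_intros)
  moreover have "eventually (\<lambda>\<tau>. norm (c + \<tau> *\<^sub>R d) \<le> 1) (at_left R)"
  proof (rule eventually_mono)
    show "eventually (\<lambda>\<tau>. \<tau> \<in> {0<..<R}) (at_left R)"
      using R by (rule eventually_at_left_real)
    fix \<tau> assume "\<tau> \<in> {0<..<R}"
    then show "norm (c + \<tau> *\<^sub>R d) \<le> 1" using iff[of \<tau>] by simp
  qed
  ultimately have "norm (c + R *\<^sub>R d) \<le> 1"
    by (intro tendsto_upperbound) auto
  moreover have "\<not> norm (c + R *\<^sub>R d) < 1" using iff R by simp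
  ultimately show ?thesis by linarith
qed

lemma complex_line_directions:
  assumes "c \<in> complex_line x y" "w \<in> complex_line x y"
  obtains t where "w = c + t *s (y - x)"
proof -
  obtain a b where "c = x + a *s (y - x)" "w = x + b *s (y - x)"
    using assms by (auto simp: complex_line_def)
  then have "w = c + (b - a) *s (y - x)" by (simp add: vec.scale_left_diff_distrib)
  then show ?thesis using that by blast
qed

lemma complex_line_shift:
  assumes "c \<in> complex_line x y"
  shows "c + t *s (y - x) \<in> complex_line x y"
proof -
  obtain a where "c = x + a *s (y - x)"
    using assms by (auto simp: complex_line_def)
  then have "c + t *s (y - x) = x + (a + t) *s (y - x)" by (simp add: vec.scale_left_distrib)
  then show ?thesis unfolding complex_line_def by (metis rangeI)
qed

lemma norm_add_sq: "(norm (a + b))\<^sup>2 = (norm a)\<^sup>2 + 2 * (a \<bullet> b) + (norm (b :: 'a::real_inner))\<^sup>2"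
  by (simp add: power2_norm_eq_inner inner_add inner_commute)

text \<open>The power of a point of the line is the same for the unit sphere and for the boundary
  circle of the disc. This turns orthogonality of a geodesic circle into
  \<open>(norm p)\<^sup>2 = 1 + \<rho>\<^sup>2\<close>, in which \<open>c\<close> and
  \<open>R\<close> no longer occur.\<close>

lemma ball_section_power:
  fixes x y :: "complex ^ 'n"
  assumes sec: "is_ball_section (complex_line x y) c R" and w: "w \<in> complex_line x y"
    and "x \<noteq> y"
  shows "(norm w)\<^sup>2 - 1 = (dist w c)\<^sup>2 - R\<^sup>2"
proof -
  have c: "c \<in> complex_line x y" and R: "R > 0" using sec by (auto simp: is_ball_section_def)
  obtain t where t: "w = c + t *s (y - x)" using complex_line_directions[OF c w] .
  \<comment> \<open>For \<open>w = c\<close> the factor \<open>t\<close> is 0 and gives no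
    direction; \<open>y - x\<close> itself is taken then.\<close>
  define t' where "t' = (if t = 0 then 1 else t)"
  define d where "d = t' *s (y - x)"
  have t'0: "t' \<noteq> 0" by (auto simp: t'_def)
  have d0: "norm d > 0" using t'0 \<open>x \<noteq> y\<close> by (simp add: d_def norm_complex_smult)
  define e where "e = (1 / norm d) *\<^sub>R d"
  have e: "norm e = 1" using d0 by (simp add: e_def)
  have mem: "c + \<tau> *\<^sub>R e \<in> complex_line x y" for \<tau>
    using complex_line_shift[OF c, of "of_real (\<tau> / norm d) * t'"]
    by (simp add: e_def d_def scaleR_eq_smult vector_smult_assoc)
  have mem': "c + \<tau> *\<^sub>R (- e) \<in> complex_line x y" for \<tau>
    using mem[of "- \<tau>"] by simp
  \<comment> \<open>Both ends of a diameter lie on the unit sphere. Subtracting the two equations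
    makes \<open>c\<close> orthogonal to \<open>e\<close>; adding them gives
    \<open>(norm c)\<^sup>2 + R\<^sup>2 = 1\<close>.\<close>
  have "norm (c + R *\<^sub>R e) = 1" "norm (c + R *\<^sub>R (- e)) = 1"
    by (intro ball_section_boundary[OF sec]; simp add: e mem mem' del: scaleR_minus_right)+
  then have "(norm (c + R *\<^sub>R e))\<^sup>2 = 1" "(norm (c + R *\<^sub>R (- e)))\<^sup>2 = 1" by simp_all
  then have *: "(norm c)\<^sup>2 + 2 * (c \<bullet> (R *\<^sub>R e)) + R\<^sup>2 = 1" "(norm c)\<^sup>2 - 2 * (c \<bullet> (R *\<^sub>R e)) + R\<^sup>2 = 1"
    unfolding norm_add_sq by (simp_all add: e)
  then have "c \<bullet> (R *\<^sub>R e) = 0" by linarith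
  then have "c \<bullet> d = 0" using R d0 by (simp add: e_def)
  moreover obtain k :: real where k: "w - c = k *\<^sub>R d"
    by (cases "t = 0") (auto simp: t d_def t'_def intro: that[of 0] that[of 1])
  ultimately have "c \<bullet> (w - c) = 0" by simp
  then have "(norm w)\<^sup>2 = (norm c)\<^sup>2 + (norm (w - c))\<^sup>2"
    using norm_add_sq[of c "w - c"] by simp
  moreover have "(norm c)\<^sup>2 + R\<^sup>2 = 1" using * by linarith
  ultimately show ?thesis by (simp add: dist_norm)
qed

section \<open>Hermitian forms on segments and on geodesic arcs\<close>

text \<open>The factor of \<beta> is the squared distance from \<open>z\<close> to the complex line
  of the \<open>i\<close>-th axis.\<close>

definition quadric :: "'n \<Rightarrow> real \<Rightarrow> real \<Rightarrow> complex ^ 'n \<Rightarrow> real" where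
  "quadric i \<alpha> \<beta> z = \<alpha> * (norm z)\<^sup>2 + \<beta> * ((norm z)\<^sup>2 - (cmod (z $ i))\<^sup>2)"

definition quadric_bilin :: "'n \<Rightarrow> real \<Rightarrow> real \<Rightarrow> complex ^ 'n \<Rightarrow> complex ^ 'n \<Rightarrow> real" where
  "quadric_bilin i \<alpha> \<beta> z w = \<alpha> * (z \<bullet> w) + \<beta> * (z \<bullet> w - z $ i \<bullet> w $ i)"

lemma quadric_add:
  "quadric i \<alpha> \<beta> (z + w) = quadric i \<alpha> \<beta> z + 2 * quadric_bilin i \<alpha> \<beta> z w + quadric i \<alpha> \<beta> w"
  by (simp add: quadric_def quadric_bilin_def norm_add_sq inner_commute algebra_simps)

lemma quadric_bilin_combination:
  "quadric_bilin i \<alpha> \<beta> z (a *\<^sub>R u + b *\<^sub>R w)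
     = a * quadric_bilin i \<alpha> \<beta> z u + b * quadric_bilin i \<alpha> \<beta> z w"
  by (simp add: quadric_bilin_def inner_add_right algebra_simps)

lemma quadric_smult: "quadric i \<alpha> \<beta> (t *s z) = (cmod t)\<^sup>2 * quadric i \<alpha> \<beta> z"
  by (simp add: quadric_def norm_complex_smult norm_mult power_mult_distrib algebra_simps)

lemma norm_nth_complex_le: "cmod ((z :: complex ^ 'n) $ i) \<le> norm z"
  by (rule Finite_Cartesian_Product.norm_nth_le)

lemma quadric_ge: "0 \<le> \<beta> \<Longrightarrow> \<alpha> * (norm z)\<^sup>2 \<le> quadric i \<alpha> \<beta> z"
  by (simp add: quadric_def norm_nth_complex_le power_mono)

lemma quadric_scaleR: "quadric i \<alpha> \<beta> (a *\<^sub>R z) = a\<^sup>2 * quadric i \<alpha> \<beta> z"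
  by (simp add: scaleR_eq_smult quadric_smult)

text \<open>A nonnegative quadratic form is convex: it deviates from linear interpolation by
  \<open>- u * (1 - u)\<close> times its value at \<open>x - y\<close>.\<close>

lemma quadric_segment:
  assumes "0 \<le> \<alpha>" "0 \<le> \<beta>" "quadric i \<alpha> \<beta> x \<le> 1" "quadric i \<alpha> \<beta> y \<le> 1" "z \<in> closed_segment x y"
  shows "quadric i \<alpha> \<beta> z \<le> 1"
proof -
  let ?q = "quadric i \<alpha> \<beta>"
  obtain u where u: "0 \<le> u" "u \<le> 1" "z = (1 - u) *\<^sub>R x + u *\<^sub>R y"
    using assms(5) by (auto simp: in_segment)
  have "?q z = (1 - u)\<^sup>2 * ?q x + 2 * u * (1 - u) * quadric_bilin i \<alpha> \<beta> x y + u\<^sup>2 * ?q y"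
    unfolding u(3) quadric_add quadric_scaleR
    by (simp add: quadric_bilin_def algebra_simps)
  moreover have "2 * quadric_bilin i \<alpha> \<beta> x y = ?q x + ?q y - ?q (x - y)"
    using quadric_add[of i \<alpha> \<beta> x "- y"] quadric_smult[of i \<alpha> \<beta> "-1" y]
    by (simp add: quadric_bilin_def algebra_simps)
  moreover have "?q (x - y) \<ge> 0"
    using quadric_ge[OF assms(2), of \<alpha> "x - y" i] assms(1)
    by (intro order_trans[OF _ quadric_ge]) (use assms in auto)
  ultimately have "?q z = (1 - u) * ?q x + u * ?q y - u * (1 - u) * ?q (x - y)"
    by (simp add: power2_eq_square algebra_simps)
  also have "\<dots> \<le> (1 - u) * 1 + u * 1 - 0"
    using u assms(3,4) \<open>?q (x - y) \<ge> 0\<close>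
    by (intro diff_mono add_mono mult_left_mono) auto
  finally show ?thesis by simp
qed

text \<open>On a circle inside a complex line every Hermitian form agrees with a real affine function, so its
  value on the arc is controlled by the values at the end points and at the centre.\<close>

lemma quadric_arc:
  fixes x y p :: "complex ^ 'n"
  assumes "0 \<le> \<alpha>" "0 \<le> \<beta>" "quadric i \<alpha> \<beta> x \<le> 1" "quadric i \<alpha> \<beta> y \<le> 1"
    and p: "p \<in> complex_line x y" "x \<in> sphere p \<rho>" "y \<in> sphere p \<rho>" and \<rho>: "\<rho> > 0"
    and np: "(norm p)\<^sup>2 = 1 + \<rho>\<^sup>2" and large: "\<alpha> * (1 + 2 * \<rho>\<^sup>2) \<ge> 1"
    and z: "z \<in> minor_arc p \<rho> x y" and ne: "x \<noteq> y"
  shows "quadric i \<alpha> \<beta> z \<le> 1"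
proof -
  let ?q = "quadric i \<alpha> \<beta>"
  obtain a b where ab: "a \<ge> 0" "b \<ge> 0" "z - p = a *\<^sub>R (x - p) + b *\<^sub>R (y - p)" "dist p z = \<rho>"
    using z by (auto simp: minor_arc_def)
  have r: "norm (x - p) = \<rho>" "norm (y - p) = \<rho>" "norm (z - p) = \<rho>"
    using p(2,3) ab(4) by (simp_all add: dist_norm norm_minus_commute)
  \<comment> \<open>Along the complex direction of the line the form is \<kappa> times the squared
    norm, since both scale by \<open>(cmod t)\<^sup>2\<close>. Hence the quadratic part is the
    constant \<open>\<kappa> * \<rho>\<^sup>2\<close> on the circle and only an affine part
    varies.\<close>
  define \<kappa> where "\<kappa> = ?q (y - x) / (norm (y - x))\<^sup>2"
  have dir: "?q (t *s (y - x)) = \<kappa> * (norm (t *s (y - x)))\<^sup>2" for t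
    using ne unfolding quadric_smult norm_complex_smult by (simp add: \<kappa>_def power_mult_distrib)
  have "x \<in> complex_line x y" "y \<in> complex_line x y"
    unfolding complex_line_def image_iff by (auto intro!: exI[of _ 0] exI[of _ 1])
  then obtain s t where "x = p + s *s (y - x)" "y = p + t *s (y - x)"
    using complex_line_directions[OF p(1)] by meson
  then have st: "x - p = s *s (y - x)" "y - p = t *s (y - x)"
    by (metis add_diff_cancel_left')+
  have zst: "z - p = (of_real a * s + of_real b * t) *s (y - x)"
    unfolding ab(3) st by (simp add: scaleR_eq_smult vector_smult_assoc vec.scale_left_distrib)
  have on: "?q (x - p) = \<kappa> * \<rho>\<^sup>2" "?q (y - p) = \<kappa> * \<rho>\<^sup>2" "?q (z - p) = \<kappa> * \<rho>\<^sup>2"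
    using dir[of s] dir[of t] dir[of "of_real a * s + of_real b * t"] r
    unfolding st[symmetric] zst[symmetric] by simp_all
  have exp: "?q w = ?q p + 2 * quadric_bilin i \<alpha> \<beta> p (w - p) + ?q (w - p)" for w
    using quadric_add[of i \<alpha> \<beta> p "w - p"] by simp
  have "?q z = a * ?q x + b * ?q y - (a + b - 1) * (?q p + \<kappa> * \<rho>\<^sup>2)"
    unfolding exp[of z] exp[of x] exp[of y] on unfolding ab(3) quadric_bilin_combination
    by (simp add: algebra_simps)
  \<comment> \<open>The triangle inequality gives \<open>a + b \<ge> 1\<close>, and the bracket is
    at least \<open>\<alpha> * ((norm p)\<^sup>2 + \<rho>\<^sup>2) = \<alpha> * (1 + 2 *
    \<rho>\<^sup>2)\<close>.\<close>
  also have "\<dots> \<le> a * 1 + b * 1 - (a + b - 1) * 1"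
  proof -
    have "\<rho> \<le> a * \<rho> + b * \<rho>"
      using norm_triangle_ineq[of "a *\<^sub>R (x - p)" "b *\<^sub>R (y - p)"] ab r by simp
    then have "1 * \<rho> \<le> (a + b) * \<rho>" by (simp add: algebra_simps)
    then have "a + b - 1 \<ge> 0" using \<rho> by simp
    moreover have "?q p + \<kappa> * \<rho>\<^sup>2 \<ge> 1"
      using quadric_ge[OF assms(2), of \<alpha> p i] quadric_ge[OF assms(2), of \<alpha> "x - p" i] large
      unfolding np on r by (simp add: algebra_simps)
    ultimately show ?thesis using ab(1,2) assms(3,4)
      by (intro diff_mono add_mono mult_left_mono) auto
  qed
  finally show ?thesis by simp
qed

text \<open>A circle orthogonal to the unit sphere that reaches deep into the ball cannot be small:
  \<open>1 + \<rho>\<^sup>2 \<le> (\<rho> + r)\<^sup>2\<close>, so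
  \<open>\<rho> * r \<ge> 1 / 4\<close>.\<close>

lemma orthogonal_circle_radius:
  fixes x :: "complex ^ 'n"
  assumes "x \<in> cball 0 r" "0 \<le> r" "r\<^sup>2 = 1 / 2" "dist p x = \<rho>" "\<rho> > 0" "(norm p)\<^sup>2 = 1 + \<rho>\<^sup>2"
  shows "\<rho>\<^sup>2 \<ge> 1 / 8"
proof -
  have "norm p \<le> \<rho> + r"
    using assms norm_triangle_ineq[of "p - x" x] by (simp add: dist_norm)
  then have "(norm p)\<^sup>2 \<le> (\<rho> + r)\<^sup>2" by (intro power_mono) auto
  then have "1 \<le> 2 * \<rho> * r + r\<^sup>2" using assms by (simp add: power2_sum)
  then have "1 / 4 \<le> \<rho> * r" using assms by simp
  then have "(1 / 4)\<^sup>2 \<le> (\<rho> * r)\<^sup>2" by (intro power_mono) auto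
  then show ?thesis using assms(3) by (simp add: power_mult_distrib power_divide)
qed

text \<open>The pair \<open>(2, 0)\<close> confines the set to squared norm at most 1/2, so all
  geodesic circles involved have \<open>\<rho>\<^sup>2 \<ge> 1 / 8\<close>. The bound 4/5 is the
  reciprocal of \<open>1 + 2 / 8\<close>, as \<open>quadric_arc\<close> demands.\<close>

lemma h_convex_quadrics:
  fixes i :: "'n::finite"
  assumes J: "\<And>\<alpha> \<beta>. (\<alpha>, \<beta>) \<in> J \<Longrightarrow> \<alpha> \<ge> 4 / 5 \<and> \<beta> \<ge> 0" and two: "(2, 0) \<in> J"
  shows "h_convex {z. \<forall>(\<alpha>, \<beta>) \<in> J. quadric i \<alpha> \<beta> z \<le> 1}" (is "h_convex ?K")
  unfolding h_convex_def
proof (intro conjI ballI impI subsetI)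
  have small: "2 * (norm z)\<^sup>2 \<le> 1" if "z \<in> ?K" for z
    using two that by (auto simp: quadric_def)
  fix z assume "z \<in> ?K"
  then have "(norm z)\<^sup>2 < 1\<^sup>2" using small[of z] by simp
  then show "z \<in> ball 0 1" by (simp add: power_less_imp_less_base)
next
  fix x y z assume x: "x \<in> ?K" and y: "y \<in> ?K" and ne: "x \<noteq> y" and z: "z \<in> geodesic_segment x y"
  then obtain c R where sec: "is_ball_section (complex_line x y) c R" and alt:
    "z \<in> closed_segment x y \<or>
       (\<exists>p\<in>complex_line x y. \<exists>\<rho>. orthogonal_circles p \<rho> c R \<and>
            x \<in> sphere p \<rho> \<and> y \<in> sphere p \<rho> \<and> z \<in> minor_arc p \<rho> x y)"
    by (auto simp: geodesic_segment_def)
  have "quadric i \<alpha> \<beta> z \<le> 1" if "(\<alpha>, \<beta>) \<in> J" for \<alpha> \<beta>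
    using alt
  proof
    assume "z \<in> closed_segment x y"
    then show ?thesis
      by (rule quadric_segment[rotated -1]) (use J[OF that] x y that in auto)
  next
    assume "\<exists>p\<in>complex_line x y. \<exists>\<rho>. orthogonal_circles p \<rho> c R \<and>
            x \<in> sphere p \<rho> \<and> y \<in> sphere p \<rho> \<and> z \<in> minor_arc p \<rho> x y"
    then obtain p \<rho> where p: "p \<in> complex_line x y" "orthogonal_circles p \<rho> c R"
      "x \<in> sphere p \<rho>" "y \<in> sphere p \<rho>" and arc: "z \<in> minor_arc p \<rho> x y" by blast
    have \<rho>: "\<rho> > 0" and "(norm p)\<^sup>2 = 1 + \<rho>\<^sup>2"
      using p(2) ball_section_power[OF sec p(1) ne] by (auto simp: orthogonal_circles_def)
    have "2 * (norm x)\<^sup>2 \<le> 1" using two x by (auto simp: quadric_def)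
    then have "x \<in> cball 0 (sqrt (1 / 2))"
      by (simp add: real_le_rsqrt)
    then have "\<rho>\<^sup>2 \<ge> 1 / 8"
      by (rule orthogonal_circle_radius[of _ _ p]) (use p \<rho> \<open>(norm p)\<^sup>2 = 1 + \<rho>\<^sup>2\<close> in auto)
    then have "1 \<le> (4 / 5) * (1 + 2 * \<rho>\<^sup>2)" by simp
    also have "\<dots> \<le> \<alpha> * (1 + 2 * \<rho>\<^sup>2)"
      using J[OF that] by (intro mult_right_mono) auto
    finally show ?thesis
      by (intro quadric_arc[OF _ _ _ _ p(1,3,4) \<rho> \<open>(norm p)\<^sup>2 = 1 + \<rho>\<^sup>2\<close> _ arc ne])
         (use J[OF that] x y that in auto)
  qed
  then show "z \<in> ?K" by auto
qed

section \<open>Bodies of revolution\<close>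

text \<open>A body of revolution is encoded by a profile \<open>\<omega>\<close>. With \<open>v = |z\<^sub>i|\<^sup>2 / |z|\<^sup>2\<close> the square
  \<open>u = \<rho>\<^sup>2 / (1 - \<rho>\<^sup>2)\<close> of the hyperbolic sine of the radius is \<open>1 / profile_fun \<omega> v\<close>. The parameter
  \<open>t = 1 / (1 - v)\<close> makes constant profiles the tubes around the complex line of the \<open>i\<close>-th axis; the
  maximum with \<open>1\<close> intersects the tube with the ball of squared radius \<open>1/2\<close>. At \<open>v = 1\<close> the
  value is \<open>1\<close> because of the factor \<open>1 - v\<close>.\<close>

definition profile_fun :: "(real \<Rightarrow> real) \<Rightarrow> real \<Rightarrow> real" where
  "profile_fun \<omega> v = max 1 ((1 - v) * \<omega> (1 / (1 - v)))"

definition profile_body :: "'n \<Rightarrow> (real \<Rightarrow> real) \<Rightarrow> (complex ^ 'n) set" where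
  "profile_body i \<omega> = {z. (norm z)\<^sup>2 * (1 + profile_fun \<omega> ((cmod (z $ i))\<^sup>2 / (norm z)\<^sup>2)) \<le> 1}"

text \<open>Convexity is expressed by supporting lines, since each of them becomes one quadric with
  \<open>\<alpha> = 1 + d\<close>. The slope bound -1/5 is the condition
  \<open>\<alpha> \<ge> 4 / 5\<close>.\<close>

definition profile :: "(real \<Rightarrow> real) \<Rightarrow> bool" where
  "profile \<omega> \<longleftrightarrow> \<omega> \<in> borel_measurable borel \<and> (\<forall>t\<ge>1. 0 \<le> \<omega> t) \<and>
     (\<forall>t\<ge>1. \<exists>d. - 1 / 5 \<le> d \<and> d \<le> 0 \<and> (\<forall>u\<ge>1. \<omega> t + d * (u - t) \<le> \<omega> u))"

lemma profile_fun_ge_1: "1 \<le> profile_fun \<omega> v"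
  by (simp add: profile_fun_def)

text \<open>Nonpositive slopes make \<omega> largest at 1. The bound provides a ball inside the
  body.\<close>

lemma profile_fun_le:
  assumes "profile \<omega>" "0 \<le> v" "v \<le> 1"
  shows "profile_fun \<omega> v \<le> max 1 (\<omega> 1)"
proof (cases "v = 1")
  case False
  define t where "t = 1 / (1 - v)"
  have t: "t \<ge> 1" using assms False by (simp add: t_def field_simps)
  obtain d where "d \<le> 0" "\<omega> t + d * (1 - t) \<le> \<omega> 1"
    using assms(1) t by (auto simp: profile_def)
  moreover have "d * (1 - t) \<ge> 0" using t \<open>d \<le> 0\<close> by (simp add: mult_nonpos_nonpos)
  ultimately have "\<omega> t \<le> \<omega> 1" by linarith
  moreover have "0 \<le> \<omega> t" using assms(1) t by (auto simp: profile_def)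
  moreover have "(1 - v) * \<omega> t \<le> 1 * \<omega> t"
    using assms \<open>0 \<le> \<omega> t\<close> by (intro mult_right_mono) auto
  ultimately show ?thesis unfolding profile_fun_def t_def by linarith
qed (simp add: profile_fun_def)

text \<open>A supporting line, multiplied by the squared distance to the axis and increased by the
  squared norm, is a quadric. The pair \<open>(2, 0)\<close> is the ball that comes from the maximum
  with 1.\<close>

definition profile_quadrics :: "(real \<Rightarrow> real) \<Rightarrow> (real \<times> real) set" where
  "profile_quadrics \<omega> = insert (2, 0) {(1 + d, \<omega> t - d * t) | t d.
     1 \<le> t \<and> - 1 / 5 \<le> d \<and> d \<le> 0 \<and> (\<forall>u\<ge>1. \<omega> t + d * (u - t) \<le> \<omega> u)}"

text \<open>The supporting lines of \<open>\<omega>\<close> turn the body into an intersection of quadrics.\<close>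

lemma profile_body_eq_quadrics:
  fixes i :: "'n::finite"
  assumes \<omega>: "profile \<omega>"
  shows "profile_body i \<omega> = {z. \<forall>(\<alpha>, \<beta>) \<in> profile_quadrics \<omega>. quadric i \<alpha> \<beta> z \<le> 1}"
proof -
  have "z \<in> profile_body i \<omega> \<longleftrightarrow> (\<forall>(\<alpha>, \<beta>) \<in> profile_quadrics \<omega>. quadric i \<alpha> \<beta> z \<le> 1)" for z :: "complex ^ 'n"
  proof (cases "z = 0")
    case True
    then show ?thesis by (auto simp: profile_body_def quadric_def)
  next
    case False
    \<comment> \<open>\<open>A / B\<close> is the parameter \<open>t\<close> of the point;
      membership becomes \<open>2 * A \<le> 1\<close> and
      \<open>A + B * \<omega> (A / B) \<le> 1\<close>.\<close>
    define A where "A = (norm z)\<^sup>2"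
    define B where "B = A - (cmod (z $ i))\<^sup>2"
    have A: "A > 0" using False by (simp add: A_def)
    have B: "0 \<le> B" "B \<le> A" by (simp_all add: B_def A_def norm_nth_complex_le power_mono)
    have q: "quadric i \<alpha> \<beta> z = \<alpha> * A + \<beta> * B" for \<alpha> \<beta>
      by (simp add: quadric_def A_def B_def)
    have x: "1 - (cmod (z $ i))\<^sup>2 / A = B / A"
      using A by (simp add: B_def diff_divide_distrib)
    have "z \<in> profile_body i \<omega> \<longleftrightarrow> A + A * max 1 (B / A * \<omega> (A / B)) \<le> 1"
      by (simp add: profile_body_def profile_fun_def x A_def[symmetric] distrib_left)
    also have "A * max 1 (B / A * \<omega> (A / B)) = max A (B * \<omega> (A / B))"
      using A by (simp add: max_mult_distrib_left)
    finally have mem: "z \<in> profile_body i \<omega> \<longleftrightarrow> 2 * A \<le> 1 \<and> A + B * \<omega> (A / B) \<le> 1"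
      by (auto simp: max_def)
    have line: "(1 + d) * A + (\<omega> t - d * t) * B = A + B * (\<omega> t + d * (A / B - t))" if "B > 0" for t d
      using that by (simp add: field_simps)
    show ?thesis
    proof
      assume "z \<in> profile_body i \<omega>"
      then have bd: "2 * A \<le> 1" "A + B * \<omega> (A / B) \<le> 1" using mem by auto
      have "(1 + d) * A + (\<omega> t - d * t) * B \<le> 1"
        if t: "1 \<le> t" "- 1 / 5 \<le> d" "d \<le> 0" "\<forall>u\<ge>1. \<omega> t + d * (u - t) \<le> \<omega> u" for t d
      \<comment> \<open>On the axis \<open>A / B\<close> is 0 by convention, outside the range of
        the supporting lines; there \<open>d \<le> 0\<close> and \<open>2 * A \<le> 1\<close> give
        the bound.\<close>
      proof (cases "B = 0")
        case True
        have "(1 + d) * A \<le> 1 * A" using that A by (intro mult_right_mono) auto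
        then have "(1 + d) * A \<le> 1" using bd A by linarith
        then show ?thesis using True by simp
      next
        case False
        then have "B > 0" "A / B \<ge> 1" using B by auto
        then have "B * (\<omega> t + d * (A / B - t)) \<le> B * \<omega> (A / B)"
          using t by (intro mult_left_mono) auto
        then show ?thesis using bd line[OF \<open>B > 0\<close>] by simp
      qed
      then show "\<forall>(\<alpha>, \<beta>) \<in> profile_quadrics \<omega>. quadric i \<alpha> \<beta> z \<le> 1"
        using bd by (auto simp: profile_quadrics_def q)
    next
      assume all: "\<forall>(\<alpha>, \<beta>) \<in> profile_quadrics \<omega>. quadric i \<alpha> \<beta> z \<le> 1"
      then have "2 * A \<le> 1" by (auto simp: profile_quadrics_def q)
      moreover have "A + B * \<omega> (A / B) \<le> 1"
      proof (cases "B = 0")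
        case False
        then have t: "B > 0" "A / B \<ge> 1" using B by auto
        then obtain d where "- 1 / 5 \<le> d" "d \<le> 0" "\<forall>u\<ge>1. \<omega> (A / B) + d * (u - A / B) \<le> \<omega> u"
          using \<omega> unfolding profile_def by meson
        then have "(1 + d, \<omega> (A / B) - d * (A / B)) \<in> profile_quadrics \<omega>"
          unfolding profile_quadrics_def using t by blast
        then have "(1 + d) * A + (\<omega> (A / B) - d * (A / B)) * B \<le> 1"
          using all q by fastforce
        then show ?thesis unfolding line[OF t(1)] by simp
      qed (use \<open>2 * A \<le> 1\<close> A in simp)
      ultimately show "z \<in> profile_body i \<omega>" using mem by blast
    qed
  qed
  then show ?thesis by blast
qed

lemma h_convex_profile_body:
  fixes i :: "'n::finite"
  assumes "profile \<omega>"
  shows "h_convex (profile_body i \<omega>)"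
  unfolding profile_body_eq_quadrics[OF assms]
proof (rule h_convex_quadrics)
  fix \<alpha> \<beta> assume "(\<alpha>, \<beta>) \<in> profile_quadrics \<omega>"
  moreover have "0 \<le> \<omega> t - d * t" if "1 \<le> t" "d \<le> 0" for t d
    using that assms mult_nonpos_nonneg[of d t] by (auto simp: profile_def)
  ultimately show "4 / 5 \<le> \<alpha> \<and> 0 \<le> \<beta>" by (auto simp: profile_quadrics_def)
qed (simp add: profile_quadrics_def)

lemma body_profile_body:
  fixes i :: "'n::finite"
  assumes "profile \<omega>"
  shows "body (profile_body i \<omega>)"
proof -
  have "profile_body i \<omega> = (\<Inter>(\<alpha>, \<beta>) \<in> profile_quadrics \<omega>. {z. quadric i \<alpha> \<beta> z \<le> 1})"
    unfolding profile_body_eq_quadrics[OF assms] by auto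
  moreover have "closed {z :: complex ^ 'n. quadric i \<alpha> \<beta> z \<le> 1}" for \<alpha> \<beta>
    unfolding quadric_def by (intro closed_Collect_le continuous_intros)
  ultimately have "closed (profile_body i \<omega>)" by auto
  moreover have "bounded (profile_body i \<omega>)"
    using h_convex_profile_body[OF assms] bounded_ball bounded_subset unfolding h_convex_def by blast
  moreover have "0 \<in> interior (profile_body i \<omega>)"
  proof (rule interiorI)
    \<comment> \<open>\<open>M\<close> bounds one plus the profile function, so all points of
      squared norm at most \<open>1 / M\<close> lie in the body.\<close>
    define M where "M = 1 + max 1 (\<omega> 1)"
    have M: "M \<ge> 2" by (simp add: M_def)
    show "open (ball (0 :: complex ^ 'n) (1 / sqrt M))" by simp
    show "0 \<in> ball (0 :: complex ^ 'n) (1 / sqrt M)" using M by simp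
    show "ball 0 (1 / sqrt M) \<subseteq> profile_body i \<omega>"
    proof
      fix z :: "complex ^ 'n" assume "z \<in> ball 0 (1 / sqrt M)"
      then have "(norm z)\<^sup>2 \<le> (1 / sqrt M)\<^sup>2" by (intro power_mono) auto
      then have z: "(norm z)\<^sup>2 \<le> 1 / M" using M by (simp add: power_divide)
      have "(cmod (z $ i))\<^sup>2 / (norm z)\<^sup>2 \<le> 1"
        using norm_nth_complex_le[of z i] by (simp add: divide_le_eq_1 power_mono)
      then have "1 + profile_fun \<omega> ((cmod (z $ i))\<^sup>2 / (norm z)\<^sup>2) \<le> M"
        using profile_fun_le[OF assms, of "(cmod (z $ i))\<^sup>2 / (norm z)\<^sup>2"] by (simp add: M_def)
      then have "(norm z)\<^sup>2 * (1 + profile_fun \<omega> ((cmod (z $ i))\<^sup>2 / (norm z)\<^sup>2)) \<le> (1 / M) * M"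
        using z profile_fun_ge_1[of \<omega> "(cmod (z $ i))\<^sup>2 / (norm z)\<^sup>2"] M
        by (intro mult_mono) auto
      then show "z \<in> profile_body i \<omega>" using M by (simp add: profile_body_def)
    qed
  qed
  ultimately show ?thesis by (simp add: body_def compact_eq_bounded_closed)
qed

text \<open>The function defining the body is homogeneous of degree two under real scaling, so the
  admissible dilation factors form the half line that starts at its square root.\<close>

lemma minkowski_functional_profile_body:
  fixes i :: "'n::finite" and z :: "complex ^ 'n"
  shows "minkowski_functional (profile_body i \<omega>) z
    = norm z * sqrt (1 + profile_fun \<omega> ((cmod (z $ i))\<^sup>2 / (norm z)\<^sup>2))"
proof -
  define h where "h z = (norm z)\<^sup>2 * (1 + profile_fun \<omega> ((cmod (z $ i))\<^sup>2 / (norm z)\<^sup>2))" for z :: "complex ^ 'n"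
  have h0: "h z > 0" if "z \<noteq> 0" for z
    using that profile_fun_ge_1[of \<omega> "(cmod (z $ i))\<^sup>2 / (norm z)\<^sup>2"] unfolding h_def by simp
  have body: "profile_body i \<omega> = {z. h z \<le> 1}" by (simp add: profile_body_def h_def)
  have scale: "h (a *\<^sub>R z) = a\<^sup>2 * h z" for a z
    by (cases "a = 0") (simp_all add: h_def power_mult_distrib norm_mult)
  have iff: "0 \<le> a \<and> z \<in> (\<lambda>y. a *\<^sub>R y) ` profile_body i \<omega> \<longleftrightarrow> sqrt (h z) \<le> a" for a
  proof (cases "a > 0")
    case True
    have "z \<in> (\<lambda>y. a *\<^sub>R y) ` profile_body i \<omega> \<longleftrightarrow> (1 / a) *\<^sub>R z \<in> profile_body i \<omega>"
      using True by (auto simp: image_iff intro!: bexI[of _ "(1 / a) *\<^sub>R z"])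
    also have "\<dots> \<longleftrightarrow> h z \<le> a\<^sup>2"
      unfolding body mem_Collect_eq scale using True by (simp add: field_simps)
    also have "\<dots> \<longleftrightarrow> sqrt (h z) \<le> a" using True by (simp add: sqrt_le_D real_le_lsqrt h_def) (metis real_sqrt_le_iff real_sqrt_abs abs_of_pos)
    finally show ?thesis using True by simp
  next
    case False
    show ?thesis
    proof (cases "a = 0")
      case True
      have "0 \<in> profile_body i \<omega>" by (simp add: profile_body_def)
      then have "z \<in> (\<lambda>y. 0 *\<^sub>R y) ` profile_body i \<omega> \<longleftrightarrow> z = 0" by auto
      moreover have "sqrt (h z) \<le> 0 \<longleftrightarrow> z = 0" using h0[of z] h_def[of 0] by (cases "z = 0") auto
      ultimately show ?thesis using True by simp
    next
      case False
      with \<open>\<not> 0 < a\<close> have "a < 0" by simp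
      moreover have "0 \<le> sqrt (h z)" using h0[of z] by (cases "z = 0") (auto simp: h_def)
      ultimately show ?thesis by linarith
    qed
  qed
  have "minkowski_functional (profile_body i \<omega>) z = (LEAST a. sqrt (h z) \<le> a)"
    unfolding minkowski_functional_def iff ..
  also have "\<dots> = sqrt (h z)" by (rule Least_equality) auto
  finally show ?thesis by (simp add: h_def real_sqrt_mult)
qed

lemma R_theta_invariant_profile_body:
  fixes i :: "'n::finite"
  shows "R_theta_invariant (profile_body i \<omega>)"
  unfolding R_theta_invariant_def minkowski_functional_profile_body norm_complex_smult
  by (simp add: norm_mult)

lemma radial_integral:
  assumes "1 \<le> m" "q > 0"
  shows "(LBINT r = 0..1 / sqrt (1 + q). r ^ (2 * m - 1) / (1 - r\<^sup>2) ^ (m + 1)) = (1 / q) ^ m / (2 * m)"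
proof -
  define R where "R = 1 / sqrt (1 + q)"
  \<comment> \<open>A primitive of the integrand; at \<open>R\<close> the quotient
    \<open>r\<^sup>2 / (1 - r\<^sup>2)\<close> equals \<open>1 / q\<close>.\<close>
  define F where "F r = (r\<^sup>2 / (1 - r\<^sup>2)) ^ m / (2 * m)" for r :: real
  have R: "0 < R" "R < 1" "R\<^sup>2 = 1 / (1 + q)" using assms by (auto simp: R_def power_divide)
  have lt1: "r\<^sup>2 < 1" if "r \<in> {0..R}" for r
    using that R by (auto simp: abs_square_less_1)
  have "(LBINT r = ereal 0..ereal R. r ^ (2 * m - 1) / (1 - r\<^sup>2) ^ (m + 1)) = F R - F 0"
  proof (rule interval_integral_FTC_finite)
    show "continuous_on {min 0 R..max 0 R} (\<lambda>r. r ^ (2 * m - 1) / (1 - r\<^sup>2) ^ (m + 1))"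
      using R lt1 by (intro continuous_intros ballI) fastforce
    fix r assume "min 0 R \<le> r" "r \<le> max 0 R"
    then have r: "1 - r\<^sup>2 \<noteq> 0" using lt1[of r] R by auto
    obtain k where k: "m = Suc k" using assms by (cases m) auto
    have "((\<lambda>r. r\<^sup>2 / (1 - r\<^sup>2)) has_real_derivative 2 * r / (1 - r\<^sup>2)\<^sup>2) (at r)"
      by (rule derivative_eq_intros refl | use r in \<open>simp add: power2_eq_square algebra_simps\<close>)+
    from DERIV_cdivide[OF DERIV_power[OF this, of m], of "2 * m"]
    have "(F has_real_derivative m * (2 * r / (1 - r\<^sup>2)\<^sup>2 * (r\<^sup>2 / (1 - r\<^sup>2)) ^ k) / (2 * m)) (at r)"
      unfolding F_def k by simp
    also have "m * (2 * r / (1 - r\<^sup>2)\<^sup>2 * (r\<^sup>2 / (1 - r\<^sup>2)) ^ k) / (2 * m)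
        = (r\<^sup>2 / (1 - r\<^sup>2)) ^ k * (r / (1 - r\<^sup>2)\<^sup>2)"
      using assms(1) by simp
    also have "\<dots> = r ^ (2 * m - 1) / (1 - r\<^sup>2) ^ (m + 1)"
    proof -
      have "2 * m - 1 = Suc (2 * k)" "m + 1 = k + 2" using k by auto
      then show ?thesis by (simp add: power_divide power_mult power_add power2_eq_square power_mult_distrib mult_ac)
    qed
    finally show "(F has_vector_derivative r ^ (2 * m - 1) / (1 - r\<^sup>2) ^ (m + 1)) (at r within {min 0 R..max 0 R})"
      unfolding has_real_derivative_iff_has_vector_derivative by (rule has_vector_derivative_at_within)
  qed
  moreover have "F R = (1 / q) ^ m / (2 * m)"
  proof -
    have "1 - 1 / (1 + q) = q / (1 + q)" using assms by (simp add: field_simps)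
    then show ?thesis using assms unfolding F_def R(3) by simp
  qed
  moreover have "F 0 = 0" using assms by (simp add: F_def)
  ultimately show ?thesis unfolding R_def[symmetric] zero_ereal_def by simp
qed

section \<open>Lebesgue measure in orthonormal coordinates\<close>

abbreviation lborel_prod_on :: "'i set \<Rightarrow> ('i \<Rightarrow> real) measure" where
  "lborel_prod_on I \<equiv> (\<Pi>\<^sub>M i\<in>I. lborel)"

interpretation lborel_product: product_sigma_finite "\<lambda>_. lborel :: real measure"
  by standard

lemma sigma_finite_lborel_prod_on: "finite I \<Longrightarrow> sigma_finite_measure (lborel_prod_on I)"
  by (rule lborel_product.sigma_finite)

lemma distr_lborel_isometry:
  fixes c \<sigma> :: real
  assumes "\<bar>\<sigma>\<bar> = 1"
  shows "distr lborel borel (\<lambda>x. c + \<sigma> * x) = lborel"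
proof -
  have "\<sigma> \<noteq> 0" using assms by auto
  from lborel_real_affine[OF this, of c] show ?thesis using assms by (simp add: density_1)
qed

text \<open>Translations and the reflection through the origin are treated together, because the
  uniqueness argument for Haar measure uses both.\<close>

lemma nn_integral_lborel_prod_isometry:
  fixes c :: "'i \<Rightarrow> real" and \<sigma> :: real
  assumes I: "finite I" and \<sigma>: "\<bar>\<sigma>\<bar> = 1" and g[measurable]: "g \<in> borel_measurable (lborel_prod_on I)"
  shows "(\<integral>\<^sup>+f. g (\<lambda>i\<in>I. c i + \<sigma> * f i) \<partial>lborel_prod_on I) = (\<integral>\<^sup>+f. g f \<partial>lborel_prod_on I)"
proof -
  let ?T = "\<lambda>f. \<lambda>i\<in>I. c i + \<sigma> * f i"
  have T[measurable]: "?T \<in> measurable (lborel_prod_on I) (lborel_prod_on I)"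
    by measurable
  have "distr (lborel_prod_on I) (lborel_prod_on I) ?T = lborel_prod_on I"
  proof (rule lborel_product.PiM_eqI[OF I])
    fix A :: "'i \<Rightarrow> real set" assume A: "\<And>i. i \<in> I \<Longrightarrow> A i \<in> sets lborel"
    have pre: "?T -` Pi\<^sub>E I A \<inter> space (lborel_prod_on I) = (\<Pi>\<^sub>E i\<in>I. (\<lambda>x. c i + \<sigma> * x) -` A i)"
      by (auto simp: space_PiM PiE_iff extensional_def)
    have meas: "(\<lambda>x. c i + \<sigma> * x) -` A i \<in> sets lborel" if "i \<in> I" for i
      using measurable_sets[of "\<lambda>x. c i + \<sigma> * x" borel borel "A i"] A[OF that] by simp
    have "emeasure lborel ((\<lambda>x. c i + \<sigma> * x) -` A i) = emeasure lborel (A i)" if "i \<in> I" for i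
      by (subst (2) distr_lborel_isometry[OF \<sigma>, of "c i", symmetric], subst emeasure_distr)
         (use A[OF that] in auto)
    then show "emeasure (distr (lborel_prod_on I) (lborel_prod_on I) ?T) (Pi\<^sub>E I A)
        = (\<Prod>i\<in>I. emeasure lborel (A i))"
      using A I meas by (subst emeasure_distr) (auto simp: pre lborel_product.emeasure_PiM)
  qed simp
  then show ?thesis using nn_integral_distr[OF T, of g] by simp
qed

definition combine :: "'a::real_vector set \<Rightarrow> ('a \<Rightarrow> real) \<Rightarrow> 'a" where
  "combine B f = (\<Sum>b\<in>B. f b *\<^sub>R b)"

lemma measurable_combine[measurable]:
  fixes B :: "'a::euclidean_space set"
  shows "combine B \<in> borel_measurable (lborel_prod_on B)"
  unfolding combine_def by measurable

lemma combine_in_span: "combine B f \<in> span B"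
  unfolding combine_def by (intro span_sum span_scale span_base)

lemma nn_integral_combine_translate:
  fixes B :: "'a::euclidean_space set"
  assumes "finite B" "h \<in> span B" "\<bar>\<sigma>\<bar> = 1" and [measurable]: "g \<in> borel_measurable borel"
  shows "(\<integral>\<^sup>+f. g (h + \<sigma> *\<^sub>R combine B f) \<partial>lborel_prod_on B) = (\<integral>\<^sup>+f. g (combine B f) \<partial>lborel_prod_on B)"
proof -
  obtain c where c: "h = combine B c"
    using assms(1,2) unfolding combine_def by (auto simp: span_finite)
  have "combine B (\<lambda>b\<in>B. c b + \<sigma> * f b) = h + \<sigma> *\<^sub>R combine B f" for f
    by (simp add: c combine_def scaleR_left_distrib sum.distrib scaleR_sum_right cong: sum.cong)
  then show ?thesis
    using nn_integral_lborel_prod_isometry[OF assms(1,3), of "\<lambda>f. g (combine B f)" c] by simp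
qed

text \<open>Uniqueness of Haar measure: apply Tonelli and translate twice.\<close>

lemma nn_integral_combine_swap:
  fixes B C :: "'a::euclidean_space set"
  assumes fin: "finite B" "finite C" and span: "span B = span C"
    and [measurable]: "F \<in> borel_measurable borel" "G \<in> borel_measurable borel"
  shows "(\<integral>\<^sup>+f. F (combine B f) \<partial>lborel_prod_on B) * (\<integral>\<^sup>+f. G (combine C f) \<partial>lborel_prod_on C)
       = (\<integral>\<^sup>+f. F (combine C f) \<partial>lborel_prod_on C) * (\<integral>\<^sup>+f. G (combine B f) \<partial>lborel_prod_on B)"
    (is "?FB * ?GC = ?FC * ?GB")
proof -
  interpret pair_sigma_finite "lborel_prod_on B" "lborel_prod_on C"
    by (intro pair_sigma_finite.intro sigma_finite_lborel_prod_on fin)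
  have mem: "combine C y \<in> span B" "combine B x \<in> span C" for x y
    using combine_in_span span by blast+
  have "?FB * ?GC = (\<integral>\<^sup>+y. ?FB * G (combine C y) \<partial>lborel_prod_on C)"
    by (simp add: nn_integral_cmult)
  \<comment> \<open>First translation: the \<open>B\<close>-integral of \<open>F\<close> is shifted
    by \<open>combine C y\<close>, which lies in the common span.\<close>
  also have "\<dots> = (\<integral>\<^sup>+y. (\<integral>\<^sup>+x. F (combine C y + combine B x) * G (combine C y) \<partial>lborel_prod_on B) \<partial>lborel_prod_on C)"
    using nn_integral_combine_translate[OF fin(1) mem(1), of 1 F]
    by (simp add: nn_integral_multc)
  also have "\<dots> = (\<integral>\<^sup>+x. (\<integral>\<^sup>+y. F (combine C y + combine B x) * G (combine C y) \<partial>lborel_prod_on C) \<partial>lborel_prod_on B)"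
    by (rule Fubini') measurable
  also have "\<dots> = (\<integral>\<^sup>+x. (\<integral>\<^sup>+y. F (combine C y) * G (combine C y - combine B x) \<partial>lborel_prod_on C) \<partial>lborel_prod_on B)"
  proof (rule nn_integral_cong)
    fix x
    show "(\<integral>\<^sup>+y. F (combine C y + combine B x) * G (combine C y) \<partial>lborel_prod_on C)
        = (\<integral>\<^sup>+y. F (combine C y) * G (combine C y - combine B x) \<partial>lborel_prod_on C)"
      using nn_integral_combine_translate[OF fin(2) mem(2)[of x], of 1 "\<lambda>z. F z * G (z - combine B x)"]
      by (simp add: add.commute)
  qed
  also have "\<dots> = (\<integral>\<^sup>+y. (\<integral>\<^sup>+x. F (combine C y) * G (combine C y - combine B x) \<partial>lborel_prod_on B) \<partial>lborel_prod_on C)"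
    by (rule Fubini'[symmetric]) measurable
  \<comment> \<open>For fixed \<open>y\<close>, reflection followed by translation reduces the inner
    integral to that of \<open>G\<close> over \<open>B\<close>.\<close>
  also have "\<dots> = (\<integral>\<^sup>+y. F (combine C y) * ?GB \<partial>lborel_prod_on C)"
    using nn_integral_combine_translate[OF fin(1) mem(1), of "-1" G]
    by (simp add: nn_integral_cmult)
  also have "\<dots> = ?FC * ?GB" by (simp add: nn_integral_multc)
  finally show ?thesis .
qed

section \<open>Sums of squares of coordinates\<close>

lemma measurable_sum_squares[measurable]: "(\<lambda>(x, y). x\<^sup>2 + y\<^sup>2 :: real) \<in> borel_measurable borel"
  unfolding borel_prod[symmetric] by measurable

text \<open>A disc of squared radius \<open>t\<close> has area \<open>pi * t\<close>, and the half
  lines form a generating family stable under intersection.\<close>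

lemma distr_sum_squares:
  "distr lborel borel (\<lambda>(x, y). x\<^sup>2 + y\<^sup>2 :: real) = density lborel (\<lambda>t. ennreal pi * indicator {0..} t)"
proof (rule measure_eqI_generator_eq[where E = "range atMost" and \<Omega> = UNIV and A = "\<lambda>n. {..real n}"])
  have *: "emeasure (distr lborel borel (\<lambda>(x, y). x\<^sup>2 + y\<^sup>2 :: real)) {..t} = ennreal (pi * max 0 t)" for t
  proof -
    have "emeasure (distr lborel borel (\<lambda>(x, y). x\<^sup>2 + y\<^sup>2 :: real)) {..t}
        = emeasure lborel {p :: real \<times> real. (fst p)\<^sup>2 + (snd p)\<^sup>2 \<le> t}"
      by (subst emeasure_distr) (auto simp: case_prod_beta vimage_def)
    also have "\<dots> = ennreal (pi * max 0 t)"
    proof (cases "t < 0")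
      case True
      have "\<not> (a\<^sup>2 + b\<^sup>2 \<le> t)" for a b :: real
        using True sum_power2_ge_zero[of a b] by linarith
      then show ?thesis using True by simp
    next
      case False
      then have "{p :: real \<times> real. (fst p)\<^sup>2 + (snd p)\<^sup>2 \<le> t} = cball 0 (sqrt t)"
        by (auto simp: dist_norm norm_prod_def)
      then show ?thesis using False
        by (simp add: emeasure_cball unit_ball_vol_2 DIM_prod)
    qed
    finally show ?thesis .
  qed
  have **: "emeasure (density lborel (\<lambda>t. ennreal pi * indicator {0..} t)) {..t} = ennreal (pi * max 0 t)" for t
  proof -
    have "emeasure (density lborel (\<lambda>t. ennreal pi * indicator {0..} t)) {..t}
        = (\<integral>\<^sup>+x. ennreal pi * indicator {0..t} x \<partial>lborel)"
      by (subst emeasure_density) (auto intro!: nn_integral_cong split: split_indicator)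
    also have "\<dots> = ennreal (pi * max 0 t)"
      by (subst nn_integral_cmult) (auto simp: ennreal_mult max_def)
    finally show ?thesis .
  qed
  show "emeasure (distr lborel borel (\<lambda>(x, y). x\<^sup>2 + y\<^sup>2 :: real)) X
      = emeasure (density lborel (\<lambda>t. ennreal pi * indicator {0..} t)) X" if "X \<in> range atMost" for X
    using that * ** by auto
  show "emeasure (distr lborel borel (\<lambda>(x, y). x\<^sup>2 + y\<^sup>2 :: real)) {..real i} \<noteq> \<infinity>" for i
    by (simp add: *)
  show "(\<Union>i. {..real i}) = UNIV" using real_arch_simple by auto
  show "Int_stable (range (atMost :: real \<Rightarrow> _))" by (auto simp: Int_stable_def)
qed (auto simp: borel_eq_atMost)

lemma nn_integral_sum_squares:
  assumes [measurable]: "h \<in> borel_measurable borel"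
  shows "(\<integral>\<^sup>+x. (\<integral>\<^sup>+y. h (x\<^sup>2 + y\<^sup>2) \<partial>lborel) \<partial>(lborel :: real measure))
     = (\<integral>\<^sup>+t. ennreal pi * indicator {0..} t * h (t :: real) \<partial>lborel)"
proof -
  have "(\<integral>\<^sup>+x. (\<integral>\<^sup>+y. h (x\<^sup>2 + y\<^sup>2) \<partial>lborel) \<partial>(lborel :: real measure))
      = (\<integral>\<^sup>+p. h ((fst p)\<^sup>2 + (snd p)\<^sup>2) \<partial>(lborel \<Otimes>\<^sub>M lborel))"
    by (subst lborel.nn_integral_fst[symmetric]) (auto simp: case_prod_beta)
  also have "\<dots> = (\<integral>\<^sup>+p. h ((\<lambda>(x, y). x\<^sup>2 + y\<^sup>2) p) \<partial>lborel)"
    by (simp add: lborel_prod case_prod_beta)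
  also have "\<dots> = (\<integral>\<^sup>+t. h t \<partial>distr lborel borel (\<lambda>(x, y). x\<^sup>2 + y\<^sup>2))"
    by (subst nn_integral_distr) auto
  also have "\<dots> = (\<integral>\<^sup>+t. ennreal pi * indicator {0..} t * h t \<partial>lborel)"
    unfolding distr_sum_squares by (subst nn_integral_density) auto
  finally show ?thesis .
qed

text \<open>A pair of coordinates enters only through its sum of squares. Keeping \<Phi> as a
  function of two sums serves both the induction over dimension and the later splitting along a
  complex line.\<close>

lemma nn_integral_insert_two:
  assumes I: "finite I" "a \<notin> I" "b \<notin> I" "a \<noteq> b"
    and [measurable]: "case_prod \<Phi> \<in> borel_measurable (borel \<Otimes>\<^sub>M borel)"
  shows "(\<integral>\<^sup>+f. \<Phi> ((f a)\<^sup>2 + (f b)\<^sup>2) (\<Sum>i\<in>I. (f i)\<^sup>2) \<partial>lborel_prod_on (insert a (insert b I)))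
     = (\<integral>\<^sup>+f. (\<integral>\<^sup>+\<tau>. ennreal pi * indicator {0..} \<tau> * \<Phi> \<tau> (\<Sum>i\<in>I. (f i)\<^sup>2) \<partial>lborel) \<partial>lborel_prod_on I)"
proof -
  have [measurable]: "(\<lambda>x. \<Phi> (u x) (v x)) \<in> borel_measurable M"
    if [measurable]: "u \<in> borel_measurable M" "v \<in> borel_measurable M" for u v and M :: "'m measure"
    using measurable_compose[of "\<lambda>x. (u x, v x)" M "borel \<Otimes>\<^sub>M borel" "case_prod \<Phi>" borel] by simp
  have sums: "(\<Sum>i\<in>I. ((f(b := x, a := y)) i)\<^sup>2) = (\<Sum>i\<in>I. (f i)\<^sup>2)" for f :: "_ \<Rightarrow> real" and x y
    using I by (intro sum.cong) auto
  have "(\<integral>\<^sup>+f. \<Phi> ((f a)\<^sup>2 + (f b)\<^sup>2) (\<Sum>i\<in>I. (f i)\<^sup>2) \<partial>lborel_prod_on (insert a (insert b I)))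
      = (\<integral>\<^sup>+f. (\<integral>\<^sup>+y. \<Phi> (y\<^sup>2 + (f b)\<^sup>2) (\<Sum>i\<in>I. ((f(a := y)) i)\<^sup>2) \<partial>lborel) \<partial>lborel_prod_on (insert b I))"
    using I by (subst lborel_product.product_nn_integral_insert) auto
  also have "\<dots> = (\<integral>\<^sup>+f. (\<integral>\<^sup>+x. (\<integral>\<^sup>+y. \<Phi> (y\<^sup>2 + x\<^sup>2) (\<Sum>i\<in>I. ((f(b := x, a := y)) i)\<^sup>2) \<partial>lborel) \<partial>lborel) \<partial>lborel_prod_on I)"
    using I by (subst lborel_product.product_nn_integral_insert) auto
  also have "\<dots> = (\<integral>\<^sup>+f. (\<integral>\<^sup>+x. (\<integral>\<^sup>+y. \<Phi> (x\<^sup>2 + y\<^sup>2) (\<Sum>i\<in>I. (f i)\<^sup>2) \<partial>lborel) \<partial>lborel) \<partial>lborel_prod_on I)"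
    unfolding sums by (simp add: add.commute)
  also have "\<dots> = (\<integral>\<^sup>+f. (\<integral>\<^sup>+\<tau>. ennreal pi * indicator {0..} \<tau> * \<Phi> \<tau> (\<Sum>i\<in>I. (f i)\<^sup>2) \<partial>lborel) \<partial>lborel_prod_on I)"
    by (subst nn_integral_sum_squares) auto
  finally show ?thesis .
qed

text \<open>Induction by two dimensions: the density of the squared norm is convolved with the
  constant \<open>pi\<close> on the half line, and integrating \<open>t ^ j\<close> up to
  \<open>w\<close> produces the next power and factorial.\<close>

lemma nn_integral_sum_squares_even:
  assumes "finite I" "card I = 2 * Suc j" and [measurable]: "h \<in> borel_measurable borel"
  shows "(\<integral>\<^sup>+f. h (\<Sum>i\<in>I. (f i)\<^sup>2) \<partial>lborel_prod_on I)
    = (\<integral>\<^sup>+t. ennreal (pi ^ Suc j / fact j * t ^ j) * indicator {0..} t * h t \<partial>lborel)"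
  using assms
proof (induction j arbitrary: I h)
  case (0 I h)
  then obtain a b where ab: "I = {a, b}" "a \<noteq> b" by (auto simp: card_2_iff numeral_2_eq_2[symmetric])
  note [measurable] = 0(3)
  have "(\<integral>\<^sup>+f. h (\<Sum>i\<in>I. (f i)\<^sup>2) \<partial>lborel_prod_on I)
      = (\<integral>\<^sup>+f. h (((f a)\<^sup>2 + (f b)\<^sup>2) + (\<Sum>i\<in>{}. (f i)\<^sup>2)) \<partial>lborel_prod_on (insert a (insert b {})))"
    using ab by simp
  also have "\<dots> = (\<integral>\<^sup>+f. (\<integral>\<^sup>+\<tau>. ennreal pi * indicator {0..} \<tau> * h (\<tau> + (\<Sum>i\<in>{}. (f i)\<^sup>2)) \<partial>lborel) \<partial>lborel_prod_on ({} :: 'a set))"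
    using ab by (intro nn_integral_insert_two) auto
  also have "\<dots> = (\<integral>\<^sup>+\<tau>. ennreal pi * indicator {0..} \<tau> * h \<tau> \<partial>lborel)"
    by (simp add: PiM_empty nn_integral_count_space_finite)
  finally show ?case by simp
next
  case (Suc j I h)
  note [measurable] = Suc.prems(3)
  obtain a where a: "a \<in> I" using Suc.prems by (cases "I = {}") auto
  have "card (I - {a}) = Suc (2 * Suc j)" using Suc.prems a by simp
  then obtain b where b: "b \<in> I - {a}" by (cases "I - {a} = {}") auto
  define I' where "I' = I - {a} - {b}"
  have I': "I = insert a (insert b I')" "finite I'" "a \<notin> I'" "b \<notin> I'" "a \<noteq> b" "card I' = 2 * Suc j"
    using a b Suc.prems \<open>card (I - {a}) = _\<close> by (auto simp: I'_def)
  define c where "c = pi ^ Suc j / fact j"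
  have c: "c > 0" by (simp add: c_def)
  have shift: "(\<integral>\<^sup>+\<tau>. ennreal pi * indicator {0..} \<tau> * h (\<tau> + t) \<partial>lborel)
      = (\<integral>\<^sup>+w. ennreal pi * indicator {0..} (w - t) * h w \<partial>lborel)" for t
    using nn_integral_real_affine[of "\<lambda>w. ennreal pi * indicator {0..} (w - t) * h w" 1 t]
    by (simp add: add.commute)
  have "(\<integral>\<^sup>+f. h (\<Sum>i\<in>I. (f i)\<^sup>2) \<partial>lborel_prod_on I)
      = (\<integral>\<^sup>+f. h (((f a)\<^sup>2 + (f b)\<^sup>2) + (\<Sum>i\<in>I'. (f i)\<^sup>2)) \<partial>lborel_prod_on (insert a (insert b I')))"
    using I' by (simp add: add.assoc)
  also have "\<dots> = (\<integral>\<^sup>+f. (\<integral>\<^sup>+\<tau>. ennreal pi * indicator {0..} \<tau> * h (\<tau> + (\<Sum>i\<in>I'. (f i)\<^sup>2)) \<partial>lborel) \<partial>lborel_prod_on I')"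
    using I' by (intro nn_integral_insert_two) auto
  also have "\<dots> = (\<integral>\<^sup>+t. ennreal (c * t ^ j) * indicator {0..} t *
      (\<integral>\<^sup>+\<tau>. ennreal pi * indicator {0..} \<tau> * h (\<tau> + t) \<partial>lborel) \<partial>lborel)"
    unfolding c_def
    by (rule Suc.IH[OF I'(2,6), of "\<lambda>s. \<integral>\<^sup>+\<tau>. ennreal pi * indicator {0..} \<tau> * h (\<tau> + s) \<partial>lborel"]) measurable
  also have "\<dots> = (\<integral>\<^sup>+t. ennreal (c * t ^ j) * indicator {0..} t *
      (\<integral>\<^sup>+w. ennreal pi * indicator {0..} (w - t) * h w \<partial>lborel) \<partial>lborel)"
    unfolding shift ..
  also have "\<dots> = (\<integral>\<^sup>+t. (\<integral>\<^sup>+w. ennreal (c * t ^ j) * indicator {0..} t *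
      (ennreal pi * indicator {0..} (w - t) * h w) \<partial>lborel) \<partial>lborel)"
    by (simp add: nn_integral_cmult)
  also have "\<dots> = (\<integral>\<^sup>+w. (\<integral>\<^sup>+t. ennreal (c * t ^ j) * indicator {0..} t *
      (ennreal pi * indicator {0..} (w - t) * h w) \<partial>lborel) \<partial>lborel)"
    by (rule lborel_pair.Fubini'[symmetric]) measurable
  also have "\<dots> = (\<integral>\<^sup>+w. ennreal (pi ^ Suc (Suc j) / fact (Suc j) * w ^ Suc j) * indicator {0..} w * h w \<partial>lborel)"
  proof (rule nn_integral_cong)
    fix w :: real
    have "(\<integral>\<^sup>+t. ennreal (c * t ^ j) * indicator {0..} t * (ennreal pi * indicator {0..} (w - t) * h w) \<partial>lborel)
        = (\<integral>\<^sup>+t. ennreal pi * h w * (ennreal (c * t ^ j) * indicator {0..w} t) \<partial>lborel)"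
      by (intro nn_integral_cong) (auto split: split_indicator simp: mult_ac)
    also have "\<dots> = ennreal pi * h w * (\<integral>\<^sup>+t. ennreal (c * t ^ j) * indicator {0..w} t \<partial>lborel)"
      by (rule nn_integral_cmult) measurable
    also have "(\<integral>\<^sup>+t. ennreal (c * t ^ j) * indicator {0..w} t \<partial>lborel)
        = ennreal (c * w ^ Suc j / Suc j) * indicator {0..} w"
    proof (cases "0 \<le> w")
      case True
      have "(\<integral>\<^sup>+t. ennreal (c * t ^ j) * indicator {0..w} t \<partial>lborel)
          = ennreal (c * w ^ Suc j / Suc j - c * 0 ^ Suc j / Suc j)"
        using True c
        by (intro nn_integral_FTC_Icc)
           (auto intro!: derivative_eq_intros simp del: power_Suc of_nat_Suc)
      then show ?thesis using True by simp
    qed simp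
    also have "ennreal pi * h w * (ennreal (c * w ^ Suc j / Suc j) * indicator {0..} w)
        = ennreal (pi ^ Suc (Suc j) / fact (Suc j) * w ^ Suc j) * indicator {0..} w * h w"
    proof (cases "0 \<le> w")
      case True
      have "ennreal pi * ennreal (c * w ^ Suc j / Suc j) = ennreal (pi ^ Suc (Suc j) / fact (Suc j) * w ^ Suc j)"
        using c True by (subst ennreal_mult[symmetric]) (auto simp: c_def field_simps)
      then have "ennreal (pi ^ Suc (Suc j) / fact (Suc j) * w ^ Suc j) * h w
          = ennreal pi * h w * ennreal (c * w ^ Suc j / Suc j)"
        by (metis mult.assoc mult.commute)
      then show ?thesis using True by simp
    qed simp
    finally show "(\<integral>\<^sup>+t. ennreal (c * t ^ j) * indicator {0..} t * (ennreal pi * indicator {0..} (w - t) * h w) \<partial>lborel)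
        = ennreal (pi ^ Suc (Suc j) / fact (Suc j) * w ^ Suc j) * indicator {0..} w * h w" .
  qed
  finally show ?case .
qed


section \<open>Separation of the radius from the share of one complex coordinate\<close>

text \<open>With \<open>r = \<tau> + \<sigma>\<close> and \<open>w = \<tau> / r\<close> the double
  integral factors. The Jacobian \<open>r\<close> joins \<open>r ^ j\<close>, and integrating
  \<open>r ^ Suc j\<close> over the unit interval gives \<open>1 / (j + 2)\<close>.\<close>

lemma nn_integral_ratio:
  fixes h :: "real \<Rightarrow> ennreal"
  assumes [measurable]: "h \<in> borel_measurable borel"
  shows "(\<integral>\<^sup>+\<sigma>. ennreal (\<sigma> ^ j) * indicator {0..} \<sigma> *
      (\<integral>\<^sup>+\<tau>. indicator {0..} \<tau> * (h (\<tau> / (\<tau> + \<sigma>)) * indicator {0<..1} (\<tau> + \<sigma>)) \<partial>lborel) \<partial>lborel)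
    = ennreal (1 / (j + 2)) * (\<integral>\<^sup>+w. ennreal ((1 - w) ^ j) * indicator {0..1} w * h w \<partial>lborel)"
proof -
  have shift: "(\<integral>\<^sup>+\<sigma>. ennreal (\<sigma> ^ j) * indicator {0..} \<sigma> * (indicator {0..} \<tau> * (h (\<tau> / (\<tau> + \<sigma>)) * indicator {0<..1} (\<tau> + \<sigma>))) \<partial>lborel)
      = (\<integral>\<^sup>+r. ennreal ((r - \<tau>) ^ j) * indicator {0..r} \<tau> * (h (\<tau> / r) * indicator {0<..1} r) \<partial>lborel)" for \<tau>
    by (subst nn_integral_real_affine[where c = 1 and t = "- \<tau>"])
       (auto intro!: nn_integral_cong split: split_indicator)
  have scale: "(\<integral>\<^sup>+\<tau>. ennreal ((r - \<tau>) ^ j) * indicator {0..r} \<tau> * (h (\<tau> / r) * indicator {0<..1} r) \<partial>lborel)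
      = ennreal (r ^ Suc j) * indicator {0..1} r * (\<integral>\<^sup>+w. ennreal ((1 - w) ^ j) * indicator {0..1} w * h w \<partial>lborel)" for r :: real
  proof (cases "0 < r \<and> r \<le> 1")
    case True
    then have r: "r > 0" by simp
    have "(\<integral>\<^sup>+\<tau>. ennreal ((r - \<tau>) ^ j) * indicator {0..r} \<tau> * (h (\<tau> / r) * indicator {0<..1} r) \<partial>lborel)
        = ennreal r * (\<integral>\<^sup>+w. ennreal ((r - r * w) ^ j) * indicator {0..r} (r * w) * h w \<partial>lborel)"
      by (subst nn_integral_real_affine[where c = r and t = 0]) (use True in auto)
    also have "(\<integral>\<^sup>+w. ennreal ((r - r * w) ^ j) * indicator {0..r} (r * w) * h w \<partial>lborel)
        = (\<integral>\<^sup>+w. ennreal (r ^ j) * (ennreal ((1 - w) ^ j) * indicator {0..1} w * h w) \<partial>lborel)"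
    proof (rule nn_integral_cong)
      fix w :: real
      have "(r - r * w) ^ j = r ^ j * (1 - w) ^ j"
        by (simp add: power_mult_distrib[symmetric] algebra_simps)
      moreover have "indicator {0..r} (r * w) = (indicator {0..1} w :: ennreal)"
        using r by (auto split: split_indicator simp: zero_le_mult_iff)
      ultimately show "ennreal ((r - r * w) ^ j) * indicator {0..r} (r * w) * h w
          = ennreal (r ^ j) * (ennreal ((1 - w) ^ j) * indicator {0..1} w * h w)"
        using r by (auto split: split_indicator simp: ennreal_mult mult_ac)
    qed
    also have "\<dots> = ennreal (r ^ j) * (\<integral>\<^sup>+w. ennreal ((1 - w) ^ j) * indicator {0..1} w * h w \<partial>lborel)"
      by (rule nn_integral_cmult) measurable
    finally show ?thesis using True by (simp add: ennreal_mult mult_ac)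
  next
    case False
    then have "r = 0 \<or> r \<notin> {0..1}" "r \<notin> {0<..1}" by auto
    then show ?thesis by auto
  qed
  have "(\<integral>\<^sup>+\<sigma>. ennreal (\<sigma> ^ j) * indicator {0..} \<sigma> *
      (\<integral>\<^sup>+\<tau>. indicator {0..} \<tau> * (h (\<tau> / (\<tau> + \<sigma>)) * indicator {0<..1} (\<tau> + \<sigma>)) \<partial>lborel) \<partial>lborel)
    = (\<integral>\<^sup>+\<sigma>. (\<integral>\<^sup>+\<tau>. ennreal (\<sigma> ^ j) * indicator {0..} \<sigma> *
        (indicator {0..} \<tau> * (h (\<tau> / (\<tau> + \<sigma>)) * indicator {0<..1} (\<tau> + \<sigma>))) \<partial>lborel) \<partial>lborel)"
    by (intro nn_integral_cong nn_integral_cmult[symmetric]) measurable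
  also have "\<dots> = (\<integral>\<^sup>+\<tau>. (\<integral>\<^sup>+\<sigma>. ennreal (\<sigma> ^ j) * indicator {0..} \<sigma> *
        (indicator {0..} \<tau> * (h (\<tau> / (\<tau> + \<sigma>)) * indicator {0<..1} (\<tau> + \<sigma>))) \<partial>lborel) \<partial>lborel)"
    by (rule lborel_pair.Fubini'[symmetric]) measurable
  also have "\<dots> = (\<integral>\<^sup>+\<tau>. (\<integral>\<^sup>+r. ennreal ((r - \<tau>) ^ j) * indicator {0..r} \<tau> * (h (\<tau> / r) * indicator {0<..1} r) \<partial>lborel) \<partial>lborel)"
    unfolding shift ..
  also have "\<dots> = (\<integral>\<^sup>+r. (\<integral>\<^sup>+\<tau>. ennreal ((r - \<tau>) ^ j) * indicator {0..r} \<tau> * (h (\<tau> / r) * indicator {0<..1} r) \<partial>lborel) \<partial>lborel)"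
    by (rule lborel_pair.Fubini') (simp add: indicator_def[of "{0.._}"])
  also have "\<dots> = (\<integral>\<^sup>+r. ennreal (r ^ Suc j) * indicator {0..1} r \<partial>lborel) *
      (\<integral>\<^sup>+w. ennreal ((1 - w) ^ j) * indicator {0..1} w * h w \<partial>lborel)"
    unfolding scale by (rule nn_integral_multc) measurable
  also have "(\<integral>\<^sup>+r. ennreal (r ^ Suc j) * indicator {0..1} r \<partial>lborel)
      = ennreal (1 ^ Suc (Suc j) / Suc (Suc j) - 0 ^ Suc (Suc j) / Suc (Suc j))"
    by (intro nn_integral_FTC_Icc)
       (auto intro!: derivative_eq_intros simp del: power_Suc of_nat_Suc)
  finally show ?thesis by (simp add: add.commute)
qed

section \<open>Bases of complex subspaces\<close>

lemma complex_subspace_imp_subspace: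
  fixes H :: "(complex ^ 'n) set"
  shows "vec.subspace H \<Longrightarrow> subspace H"
  by (auto simp: vec.subspace_def subspace_def scaleR_eq_smult)

text \<open>A complex basis together with its multiples by the imaginary unit is a real
  basis.\<close>

lemma dim_complex_subspace:
  fixes H :: "(complex ^ 'n) set"
  assumes H: "vec.subspace H"
  shows "dim H = 2 * vec.dim H"
proof -
  obtain B where B: "B \<subseteq> H" "vec.independent B" "H \<subseteq> vec.span B" "card B = vec.dim H"
    using vec.basis_exists by blast
  have fin: "finite B" using B(2) by (rule vec.finiteI_independent)
  define \<iota> where "\<iota> z = \<i> *s z" for z :: "complex ^ 'n"
  have inj: "inj \<iota>" by (auto simp: inj_def \<iota>_def vec.scale_left_imp_eq)
  have spanB: "vec.span B = H"
    using B(1,3) H by (simp add: vec.span_minimal subset_antisym)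
  have disj: "B \<inter> \<iota> ` B = {}"
  proof (rule ccontr)
    assume "B \<inter> \<iota> ` B \<noteq> {}"
    then obtain b where b: "b \<in> B" "\<iota> b \<in> B" by auto
    have "b \<noteq> 0" using b(1) B(2) vec.dependent_zero by blast
    show False
    proof (cases "\<iota> b = b")
      case True
      then have "\<i> * b $ k = b $ k" for k by (metis \<iota>_def vector_smult_component)
      then have "b = 0" by (simp add: vec_eq_iff)
      then show False using \<open>b \<noteq> 0\<close> by simp
    next
      case False
      then have "\<iota> b \<in> vec.span (B - {\<iota> b})"
        unfolding \<iota>_def using b by (intro vec.span_scale vec.span_base) auto
      then show False using B(2) b(2) unfolding vec.dependent_def by blast
    qed
  qed
  have split: "(\<Sum>x\<in>B \<union> \<iota> ` B. f x *\<^sub>R x) = (\<Sum>b\<in>B. Complex (f b) (f (\<iota> b)) *s b)" for f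
  proof -
    have "(\<Sum>x\<in>B \<union> \<iota> ` B. f x *\<^sub>R x) = (\<Sum>b\<in>B. f b *\<^sub>R b) + (\<Sum>b\<in>B. f (\<iota> b) *\<^sub>R \<iota> b)"
      using fin disj inj by (simp add: sum.union_disjoint sum.reindex inj_on_def inj_def)
    also have "\<dots> = (\<Sum>b\<in>B. Complex (f b) (f (\<iota> b)) *s b)"
      unfolding sum.distrib[symmetric]
      by (intro sum.cong refl) (auto simp: vec_eq_iff complex_eq_iff \<iota>_def)
    finally show ?thesis .
  qed
  have "independent (B \<union> \<iota> ` B)"
  proof (rule independent_if_scalars_zero)
    fix f x assume "(\<Sum>x\<in>B \<union> \<iota> ` B. f x *\<^sub>R x) = 0" and x: "x \<in> B \<union> \<iota> ` B"
    then have "Complex (f b) (f (\<iota> b)) = 0" if "b \<in> B" for b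
      using vec.independentD[OF B(2) fin subset_refl, of "\<lambda>b. Complex (f b) (f (\<iota> b))"] that
      unfolding split by blast
    then show "f x = 0" using x by (auto simp: complex_eq_iff)
  qed (use fin in simp)
  moreover have "span (B \<union> \<iota> ` B) = H"
  proof
    have "\<iota> ` B \<subseteq> H" using B(1) H by (auto simp: \<iota>_def vec.subspace_def)
    then show "span (B \<union> \<iota> ` B) \<subseteq> H"
      using B(1) complex_subspace_imp_subspace[OF H] by (intro span_minimal) auto
    show "H \<subseteq> span (B \<union> \<iota> ` B)"
    proof
      fix x assume "x \<in> H"
      then obtain u where u: "x = (\<Sum>b\<in>B. u b *s b)"
        using spanB vec.span_finite[OF fin] by auto
      also have "\<dots> = (\<Sum>b\<in>B. Re (u b) *\<^sub>R b + Im (u b) *\<^sub>R \<iota> b)"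
        by (intro sum.cong refl) (auto simp: vec_eq_iff complex_eq_iff \<iota>_def)
      also have "\<dots> \<in> span (B \<union> \<iota> ` B)"
        by (intro span_sum span_add span_scale span_base) auto
      finally show "x \<in> span (B \<union> \<iota> ` B)" .
    qed
  qed
  ultimately have "dim H = card (B \<union> \<iota> ` B)" by (metis dim_eq_card_independent dim_span)
  also have "\<dots> = 2 * card B"
    using fin disj inj by (simp add: card_Un_disjoint card_image inj_on_def inj_def)
  finally show ?thesis using B(4) by simp
qed

lemma inner_i_smult:
  fixes z w :: "complex ^ 'n"
  shows "(\<i> *s z) \<bullet> (\<i> *s w) = z \<bullet> w" "z \<bullet> (\<i> *s w) = - ((\<i> *s z) \<bullet> w)" "z \<bullet> (\<i> *s z) = 0"
proof -
  show "(\<i> *s z) \<bullet> (\<i> *s w) = z \<bullet> w" "z \<bullet> (\<i> *s w) = - ((\<i> *s z) \<bullet> w)" for w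
    unfolding inner_vec_def sum_negf[symmetric] by (intro sum.cong; simp add: inner_complex_def)+
  show "z \<bullet> (\<i> *s z) = 0"
    unfolding inner_vec_def by (intro sum.neutral) (simp add: inner_complex_def)
qed

text \<open>Projecting the \<open>i\<close>-th axis to \<open>H\<close> gives \<open>sqrt s *\<^sub>R e\<close>.\<close>

lemma adapted_basis:
  fixes H :: "(complex ^ 'n) set"
  assumes H: "vec.subspace H" and m: "vec.dim H = Suc m"
  obtains e C s where "is_orthonormal_basis H (insert e (insert (\<i> *s e) C))"
    "finite C" "e \<notin> C" "\<i> *s e \<notin> C" "e \<noteq> \<i> *s e" "card C = 2 * m" "0 \<le> s" "s \<le> 1"
    "H = UNIV \<Longrightarrow> s = 1"
    "\<And>z. z \<in> H \<Longrightarrow> (cmod (z $ i))\<^sup>2 = s * ((z \<bullet> e)\<^sup>2 + (z \<bullet> (\<i> *s e))\<^sup>2)"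
proof -
  have sub: "subspace H" using H by (rule complex_subspace_imp_subspace)
  have iH: "\<i> *s z \<in> H" if "z \<in> H" for z using that H by (auto simp: vec.subspace_def)
  \<comment> \<open>The real and imaginary parts of the coordinate are inner products with
    \<open>ax\<close> and \<open>\<i> *s ax\<close>. On \<open>H\<close> both vectors may be
    replaced by their projections, since \<open>H\<close> is closed under multiplication by
    \<open>\<i>\<close>.\<close>
  define ax :: "complex ^ 'n" where "ax = axis i 1"
  have comp: "Re (z $ i) = z \<bullet> ax" "Im (z $ i) = z \<bullet> (\<i> *s ax)" for z
    unfolding inner_i_smult(2) ax_def inner_axis by (simp_all add: inner_complex_def)
  obtain a w where aw: "a \<in> span H" "\<And>w'. w' \<in> span H \<Longrightarrow> orthogonal w w'" "ax = a + w"
    using orthogonal_subspace_decomp_exists[of H ax] by metis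
  have spanH: "span H = H" using sub by (simp add: span_eq_iff)
  have aH: "a \<in> H" and wH: "\<And>z. z \<in> H \<Longrightarrow> z \<bullet> w = 0"
    using aw spanH by (auto simp: orthogonal_def inner_commute)
  have z1: "Re (z $ i) = z \<bullet> a" "Im (z $ i) = z \<bullet> (\<i> *s a)" if "z \<in> H" for z
    using that wH[OF that] wH[OF iH[OF that]] unfolding comp aw(3)
    by (simp_all add: inner_add_right inner_i_smult(2))
  have na: "norm a \<le> 1"
  proof -
    have "(norm ax)\<^sup>2 = (norm a)\<^sup>2 + (norm w)\<^sup>2"
      unfolding aw(3) using wH[OF aH]
      by (simp add: power2_norm_eq_inner inner_add inner_commute)
    moreover have "(norm ax)\<^sup>2 = 1" by (simp add: ax_def norm_axis_1)
    moreover have "(norm w)\<^sup>2 \<ge> 0" by simp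
    ultimately have "(norm a)\<^sup>2 \<le> 1\<^sup>2" unfolding power_one by linarith
    then show ?thesis by (rule power2_le_imp_le) simp
  qed
  obtain e where e: "e \<in> H" "norm e = 1" "a = norm a *\<^sub>R e"
  \<comment> \<open>If the axis is orthogonal to \<open>H\<close>, then \<open>s\<close> will be 0
    and any unit vector of \<open>H\<close> can serve as \<open>e\<close>.\<close>
  proof (cases "a = 0")
    case True
    have "H \<noteq> {0}" using m by auto
    then obtain b where b: "b \<in> H" "b \<noteq> 0" using sub subspace_0 by blast
    then have "(1 / norm b) *\<^sub>R b \<in> H" using sub by (simp add: subspace_scale)
    then show ?thesis using True b by (intro that[of "(1 / norm b) *\<^sub>R b"]) auto
  next
    case False
    then show ?thesis using aH sub
      by (intro that[of "(1 / norm a) *\<^sub>R a"]) (auto simp: subspace_scale)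
  qed
  define e' where "e' = \<i> *s e"
  have e': "e' \<in> H" "norm e' = 1" "e \<bullet> e' = 0"
    using e(1,2) iH by (simp_all add: e'_def norm_complex_smult inner_i_smult(3))
  then have "e \<noteq> e'" using e(2) by (metis inner_eq_zero_iff norm_zero zero_neq_one)
  have ia: "\<i> *s a = norm a *\<^sub>R e'"
    using arg_cong[OF e(3), of "(*s) \<i>"]
    by (simp add: e'_def scaleR_eq_smult vector_smult_assoc mult.commute)
  \<comment> \<open>The orthogonal complement in \<open>H\<close> of the complex line through
    \<open>e\<close>; its basis completes the pair \<open>e\<close>, \<open>e'\<close>.\<close>
  define H' where "H' = {z \<in> H. z \<bullet> e = 0 \<and> z \<bullet> e' = 0}"
  have "subspace H'" using sub by (auto simp: H'_def subspace_def inner_add_left)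
  then obtain C where C: "C \<subseteq> H'" "pairwise orthogonal C" "\<And>x. x \<in> C \<Longrightarrow> norm x = 1"
      "independent C" "span C = H'"
    using orthonormal_basis_subspace[of H'] by metis
  have finC: "finite C" using C(4) by (rule independent_imp_finite)
  have nin: "e \<notin> C" "e' \<notin> C"
    using C(1) e(2) e'(2) by (force simp: H'_def power2_norm_eq_inner[symmetric])+
  let ?B = "insert e (insert e' C)"
  have pw: "pairwise orthogonal ?B"
    using C(1,2) e'(3) unfolding pairwise_insert orthogonal_def H'_def
    by (auto simp: inner_commute)
  have one: "\<forall>b\<in>?B. norm b = 1" using C(3) e e' by auto
  have spanB: "span ?B = H"
  proof
    show "span ?B \<subseteq> H" using C(1) e(1) e'(1) sub by (intro span_minimal) (auto simp: H'_def)
    show "H \<subseteq> span ?B"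
    proof
      fix z assume z: "z \<in> H"
      define y where "y = z - (z \<bullet> e) *\<^sub>R e - (z \<bullet> e') *\<^sub>R e'"
      have "y \<in> H" unfolding y_def using z e(1) e'(1) sub
        by (intro subspace_diff subspace_scale) auto
      moreover have "y \<bullet> e = 0" "y \<bullet> e' = 0"
        using e(2) e'(2,3) by (simp_all add: y_def inner_diff_left inner_commute[of e' e] norm_eq_1)
      ultimately have "y \<in> span C" using C(5) by (auto simp: H'_def)
      then have "y \<in> span ?B" using span_mono[of C ?B] by auto
      then have "y + (z \<bullet> e) *\<^sub>R e + (z \<bullet> e') *\<^sub>R e' \<in> span ?B"
        by (intro span_add span_scale) (auto intro: span_base)
      then show "z \<in> span ?B" by (simp add: y_def)
    qed
  qed
  have "0 \<notin> ?B" using one by force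
  then have "card ?B = dim H"
    using pairwise_orthogonal_independent[OF pw] spanB dim_eq_card_independent[of ?B] dim_span[of ?B] by simp
  then have card: "card C = 2 * m"
    using finC nin \<open>e \<noteq> e'\<close> m dim_complex_subspace[OF H] by simp
  have coord: "(cmod (z $ i))\<^sup>2 = (norm a)\<^sup>2 * ((z \<bullet> e)\<^sup>2 + (z \<bullet> e')\<^sup>2)" if "z \<in> H" for z
  proof -
    have "Re (z $ i) = norm a * (z \<bullet> e)" "Im (z $ i) = norm a * (z \<bullet> e')"
      using z1[OF that] e(3) ia by (metis inner_scaleR_right)+
    then show ?thesis by (simp add: cmod_power2 power_mult_distrib distrib_left)
  qed
  have univ: "(norm a)\<^sup>2 = 1" if "H = UNIV"
  proof -
    have "w = 0" using wH[of w] that by simp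
    then have "a = ax" using aw(3) by simp
    then show ?thesis by (simp add: ax_def norm_axis_1)
  qed
  show ?thesis
  proof (rule that[of e C "(norm a)\<^sup>2"])
    show "is_orthonormal_basis H (insert e (insert (\<i> *s e) C))"
      using pw one spanB by (simp add: is_orthonormal_basis_def e'_def)
  qed (use finC nin card na coord univ \<open>e \<noteq> e'\<close> in \<open>auto simp: e'_def power_le_one\<close>)
qed

section \<open>Integration over spheres in complex subspaces\<close>

lemma orthonormal_basis_coordinates:
  fixes B :: "(complex ^ 'n) set"
  assumes "is_orthonormal_basis H B"
  shows "finite B" "card B = dim H"
    "b \<in> B \<Longrightarrow> combine B f \<bullet> b = f b"
    "(norm (combine B f))\<^sup>2 = (\<Sum>b\<in>B. (f b)\<^sup>2)"
proof -
  have B: "pairwise orthogonal B" "\<And>b. b \<in> B \<Longrightarrow> norm b = 1" "span B = H"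
    using assms by (auto simp: is_orthonormal_basis_def)
  have "0 \<notin> B" using B(2) by force
  then have ind: "independent B" using B(1) by (rule pairwise_orthogonal_independent[rotated])
  then show fin: "finite B" by (rule independent_imp_finite)
  show "card B = dim H" using ind B(3) by (metis dim_eq_card_independent dim_span)
  show coord: "combine B f \<bullet> b = f b" if "b \<in> B" for b
  proof -
    have "f c *\<^sub>R c \<bullet> b = (if c = b then f b else 0)" if "c \<in> B" for c
      using that \<open>b \<in> B\<close> B(1,2) by (auto simp: norm_eq_1 pairwise_def orthogonal_def)
    then have "combine B f \<bullet> b = (\<Sum>c\<in>B. if c = b then f b else 0)"
      unfolding combine_def inner_sum_left by (intro sum.cong) auto
    then show ?thesis using fin that by simp
  qed
  have "(norm (combine B f))\<^sup>2 = combine B f \<bullet> (\<Sum>b\<in>B. f b *\<^sub>R b)"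
    by (simp add: power2_norm_eq_inner combine_def)
  also have "\<dots> = (\<Sum>b\<in>B. (f b)\<^sup>2)"
    unfolding inner_sum_right by (intro sum.cong) (simp_all add: coord power2_eq_square)
  finally show "(norm (combine B f))\<^sup>2 = (\<Sum>b\<in>B. (f b)\<^sup>2)" .
qed

text \<open>The ball has the same measure in every orthonormal basis, which fixes the normalization
  left open by \<open>nn_integral_combine_swap\<close>.\<close>

lemma nn_integral_orthonormal_ball:
  fixes B :: "(complex ^ 'n) set"
  assumes "is_orthonormal_basis H B" "dim H = 2 * Suc j"
  shows "(\<integral>\<^sup>+f. indicator (cball 0 1) (combine B f) \<partial>lborel_prod_on B)
    = ennreal (pi ^ Suc j / fact j / Suc j)"
proof -
  note B = orthonormal_basis_coordinates[OF assms(1)]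
  define c where "c = pi ^ Suc j / fact j"
  have c: "c > 0" by (simp add: c_def)
  have "indicator (cball 0 1) (combine B f) = (indicator {..1} (\<Sum>b\<in>B. (f b)\<^sup>2) :: ennreal)" for f
    unfolding B(4)[symmetric] by (auto simp: abs_square_le_1 split: split_indicator)
  then have "(\<integral>\<^sup>+f. indicator (cball 0 1) (combine B f) \<partial>lborel_prod_on B)
      = (\<integral>\<^sup>+f. indicator {..1} (\<Sum>b\<in>B. (f b)\<^sup>2) \<partial>lborel_prod_on B)"
    by simp
  also have "\<dots> = (\<integral>\<^sup>+t. ennreal (c * t ^ j) * indicator {0..} t * indicator {..1} t \<partial>lborel)"
    unfolding c_def by (rule nn_integral_sum_squares_even) (use B assms in auto)
  also have "\<dots> = (\<integral>\<^sup>+t. ennreal (c * t ^ j) * indicator {0..1} t \<partial>lborel)"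
    by (intro nn_integral_cong) (auto split: split_indicator)
  also have "\<dots> = ennreal (c * 1 ^ Suc j / Suc j - c * 0 ^ Suc j / Suc j)"
    using c by (intro nn_integral_FTC_Icc)
      (auto intro!: derivative_eq_intros simp del: power_Suc of_nat_Suc)
  finally show ?thesis by (simp add: c_def)
qed

text \<open>The swap identity with the indicator of the unit ball as second function; its integral
  is positive and finite and cancels.\<close>

lemma nn_integral_orthonormal_basis_independent:
  fixes B C :: "(complex ^ 'n) set"
  assumes B: "is_orthonormal_basis H B" and C: "is_orthonormal_basis H C" and dim: "dim H = 2 * Suc j"
    and [measurable]: "F \<in> borel_measurable borel"
  shows "(\<integral>\<^sup>+f. F (combine B f) \<partial>lborel_prod_on B) = (\<integral>\<^sup>+f. F (combine C f) \<partial>lborel_prod_on C)"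
proof -
  have meas: "(indicator (cball 0 1) :: _ \<Rightarrow> ennreal) \<in> borel_measurable (borel :: (complex ^ 'n) measure)"
    by (rule borel_measurable_indicator) (simp add: borel_closed)
  let ?V = "ennreal (pi ^ Suc j / fact j / Suc j)"
  have "(\<integral>\<^sup>+f. F (combine B f) \<partial>lborel_prod_on B) * ?V = (\<integral>\<^sup>+f. F (combine C f) \<partial>lborel_prod_on C) * ?V"
    using nn_integral_combine_swap[of B C F "indicator (cball 0 1)", OF _ _ _ _ meas]
      orthonormal_basis_coordinates(1)[OF B] orthonormal_basis_coordinates(1)[OF C] B C
    unfolding nn_integral_orthonormal_ball[OF B dim] nn_integral_orthonormal_ball[OF C dim]
    by (simp add: is_orthonormal_basis_def)
  moreover have "?V \<noteq> 0" "?V \<noteq> top" by (simp_all add: ennreal_eq_0_iff not_le)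
  ultimately show ?thesis by (metis ennreal_mult_cancel_left mult.commute)
qed

lemma measurable_sgn_vec[measurable]: "sgn \<in> borel_measurable (borel :: 'a::euclidean_space measure)"
  unfolding sgn_div_norm by measurable

text \<open>The squared modulus of the \<open>i\<close>-th coordinate is distributed like \<open>s\<close> times a Beta variable with
  parameters \<open>1\<close> and \<open>m - 1\<close>, where \<open>m\<close> is the complex dimension.\<close>

lemma nn_integral_sphere_measure:
  fixes H :: "(complex ^ 'n) set"
  assumes H: "vec.subspace H" and m: "vec.dim H = Suc (Suc j)"
  obtains s where "0 \<le> s" "s \<le> 1" "H = UNIV \<Longrightarrow> s = 1"
    "\<And>h. h \<in> borel_measurable borel \<Longrightarrow>
      (\<integral>\<^sup>+x. indicator (sphere 0 1 \<inter> H) x * h ((cmod (x $ i))\<^sup>2) \<partial>sphere_measure H)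
      = ennreal (2 * pi ^ Suc (Suc j) / fact j) *
          (\<integral>\<^sup>+w. ennreal ((1 - w) ^ j) * indicator {0..1} w * h (s * w) \<partial>lborel)"
proof -
  obtain e C s where onb: "is_orthonormal_basis H (insert e (insert (\<i> *s e) C))"
    and C: "finite C" "e \<notin> C" "\<i> *s e \<notin> C" "e \<noteq> \<i> *s e" "card C = 2 * Suc j"
    and s: "0 \<le> s" "s \<le> 1" "H = UNIV \<Longrightarrow> s = 1"
    and coord: "\<And>z. z \<in> H \<Longrightarrow> (cmod (z $ i))\<^sup>2 = s * ((z \<bullet> e)\<^sup>2 + (z \<bullet> (\<i> *s e))\<^sup>2)"
    using adapted_basis[OF H m, of i] by metis
  define e' where "e' = \<i> *s e"
  define D where "D = insert e (insert e' C)"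
  have D: "is_orthonormal_basis H D" using onb by (simp add: D_def e'_def)
  have dim: "dim H = 2 * Suc (Suc j)" using dim_complex_subspace[OF H] m by simp
  \<comment> \<open>\<open>B\<close> is the basis chosen inside \<open>lborel_subspace\<close>; the
    integral is later moved from it to the adapted basis \<open>D\<close>.\<close>
  define B where "B = (SOME B. is_orthonormal_basis H B)"
  have B: "is_orthonormal_basis H B" unfolding B_def using D by (rule someI)
  have sub: "subspace H" using H by (rule complex_subspace_imp_subspace)
  have [measurable]: "H \<in> sets borel" using closed_subspace[OF sub] by simp
  have "(\<integral>\<^sup>+x. indicator (sphere 0 1 \<inter> H) x * h ((cmod (x $ i))\<^sup>2) \<partial>sphere_measure H)
      = ennreal (2 * pi ^ Suc (Suc j) / fact j) *
          (\<integral>\<^sup>+w. ennreal ((1 - w) ^ j) * indicator {0..1} w * h (s * w) \<partial>lborel)"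
    if h[measurable]: "h \<in> borel_measurable borel" for h :: "real \<Rightarrow> ennreal"
  proof -
    have [measurable]: "sphere 0 1 \<in> sets (borel :: (complex ^ 'n) measure)"
      "cball 0 1 \<in> sets (borel :: (complex ^ 'n) measure)" by (simp_all add: borel_closed)
    have [measurable]: "(\<lambda>x :: complex ^ 'n. cmod (x $ i)) \<in> borel_measurable borel"
      by (intro borel_measurable_continuous_onI continuous_intros)
    define k where "k x = indicator (sphere 0 1 \<inter> H) x * h ((cmod (x $ i))\<^sup>2)" for x
    have [measurable]: "k \<in> borel_measurable borel" unfolding k_def by measurable
    define F where "F z = of_nat (dim H) * indicator (cball 0 1) z * k (sgn z)" for z
    have [measurable]: "F \<in> borel_measurable borel" unfolding F_def by measurable
    \<comment> \<open>\<tau> is the squared length along the complex line of \<open>e\<close> and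
      \<sigma> that of the remaining coordinates, so \<open>\<tau> / (\<tau> + \<sigma>)\<close> is
      the share of this line after normalization.\<close>
    define \<Phi> where "\<Phi> \<tau> \<sigma> = h (s * (\<tau> / (\<tau> + \<sigma>))) * indicator {0<..1} (\<tau> + \<sigma>)" for \<tau> \<sigma>
    have [measurable]: "case_prod \<Phi> \<in> borel_measurable (borel \<Otimes>\<^sub>M borel)"
      unfolding \<Phi>_def by measurable
    have [measurable]: "(\<lambda>x. \<Phi> (u x) (v x)) \<in> borel_measurable M"
      if [measurable]: "u \<in> borel_measurable M" "v \<in> borel_measurable M" for u v and M :: "'m measure"
      unfolding \<Phi>_def by measurable
    have F: "F (combine D f) = of_nat (dim H) * \<Phi> ((f e)\<^sup>2 + (f e')\<^sup>2) (\<Sum>c\<in>C. (f c)\<^sup>2)" for f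
    proof -
      let ?z = "combine D f" and ?\<tau> = "(f e)\<^sup>2 + (f e')\<^sup>2" and ?\<sigma> = "\<Sum>c\<in>C. (f c)\<^sup>2"
      have zH: "?z \<in> H" using combine_in_span[of D f] D by (simp add: is_orthonormal_basis_def)
      have "?z \<bullet> e = f e" "?z \<bullet> e' = f e'"
        using orthonormal_basis_coordinates(3)[OF D] by (auto simp: D_def)
      then have zi: "(cmod (?z $ i))\<^sup>2 = s * ?\<tau>" using coord[OF zH] by (simp add: e'_def)
      have nz: "(norm ?z)\<^sup>2 = ?\<tau> + ?\<sigma>"
        unfolding orthonormal_basis_coordinates(4)[OF D] using C by (simp add: D_def e'_def)
      show ?thesis
      \<comment> \<open>At the origin \<open>sgn\<close> is 0 and off the sphere, which matches the
        open left end of the interval in \<Phi>.\<close>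
      proof (cases "?z = 0")
        case True
        then show ?thesis using nz by (simp add: F_def k_def \<Phi>_def)
      next
        case False
        have "sgn ?z \<in> H" using zH sub by (simp add: sgn_div_norm subspace_scale)
        moreover have "(cmod (sgn ?z $ i))\<^sup>2 = s * (?\<tau> / (?\<tau> + ?\<sigma>))"
          unfolding nz[symmetric] using zi by (simp add: sgn_div_norm norm_mult power_mult_distrib field_simps)
        moreover have "indicator (cball 0 1) ?z = (indicator {0<..1} (?\<tau> + ?\<sigma>) :: ennreal)"
          unfolding nz[symmetric] using False by (auto simp: abs_square_le_1 split: split_indicator)
        ultimately show ?thesis using False
          by (simp add: F_def k_def \<Phi>_def norm_sgn mult_ac)
      qed
    qed
    have "(\<integral>\<^sup>+x. k x \<partial>sphere_measure H) = (\<integral>\<^sup>+f. F (combine B f) \<partial>lborel_prod_on B)"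
      unfolding sphere_measure_def lborel_subspace_def B_def[symmetric] Let_def combine_def[symmetric] F_def
      by (simp add: nn_integral_distr nn_integral_density)
    also have "\<dots> = (\<integral>\<^sup>+f. F (combine D f) \<partial>lborel_prod_on D)"
      by (rule nn_integral_orthonormal_basis_independent[OF B D dim]) measurable
    also have "\<dots> = of_nat (dim H) * (\<integral>\<^sup>+f. \<Phi> ((f e)\<^sup>2 + (f e')\<^sup>2) (\<Sum>c\<in>C. (f c)\<^sup>2) \<partial>lborel_prod_on D)"
      unfolding F by (rule nn_integral_cmult) (simp add: D_def, measurable)
    also have "(\<integral>\<^sup>+f. \<Phi> ((f e)\<^sup>2 + (f e')\<^sup>2) (\<Sum>c\<in>C. (f c)\<^sup>2) \<partial>lborel_prod_on D)
        = (\<integral>\<^sup>+f. (\<integral>\<^sup>+\<tau>. ennreal pi * indicator {0..} \<tau> * \<Phi> \<tau> (\<Sum>c\<in>C. (f c)\<^sup>2) \<partial>lborel) \<partial>lborel_prod_on C)"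
      unfolding D_def using C by (intro nn_integral_insert_two) (auto simp: e'_def)
    also have "\<dots> = (\<integral>\<^sup>+\<sigma>. ennreal (pi ^ Suc j / fact j * \<sigma> ^ j) * indicator {0..} \<sigma> *
        (\<integral>\<^sup>+\<tau>. ennreal pi * indicator {0..} \<tau> * \<Phi> \<tau> \<sigma> \<partial>lborel) \<partial>lborel)"
      by (rule nn_integral_sum_squares_even[OF C(1,5), of "\<lambda>\<sigma>. \<integral>\<^sup>+\<tau>. ennreal pi * indicator {0..} \<tau> * \<Phi> \<tau> \<sigma> \<partial>lborel"]) measurable
    also have "\<dots> = (\<integral>\<^sup>+\<sigma>. ennreal (pi ^ Suc (Suc j) / fact j) * (ennreal (\<sigma> ^ j) * indicator {0..} \<sigma> *
        (\<integral>\<^sup>+\<tau>. indicator {0..} \<tau> * \<Phi> \<tau> \<sigma> \<partial>lborel)) \<partial>lborel)"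
    proof (rule nn_integral_cong)
      fix \<sigma> :: real
      have "(\<integral>\<^sup>+\<tau>. ennreal pi * indicator {0..} \<tau> * \<Phi> \<tau> \<sigma> \<partial>lborel)
          = ennreal pi * (\<integral>\<^sup>+\<tau>. indicator {0..} \<tau> * \<Phi> \<tau> \<sigma> \<partial>lborel)"
        unfolding mult.assoc by (rule nn_integral_cmult) measurable
      moreover have "ennreal (pi ^ Suc j / fact j * \<sigma> ^ j) * ennreal pi = ennreal (pi ^ Suc (Suc j) / fact j) * ennreal (\<sigma> ^ j)"
        if "\<sigma> \<ge> 0" using that by (subst (1 2) ennreal_mult[symmetric]) (auto simp: mult_ac)
      ultimately show "ennreal (pi ^ Suc j / fact j * \<sigma> ^ j) * indicator {0..} \<sigma> *
          (\<integral>\<^sup>+\<tau>. ennreal pi * indicator {0..} \<tau> * \<Phi> \<tau> \<sigma> \<partial>lborel)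
        = ennreal (pi ^ Suc (Suc j) / fact j) * (ennreal (\<sigma> ^ j) * indicator {0..} \<sigma> *
          (\<integral>\<^sup>+\<tau>. indicator {0..} \<tau> * \<Phi> \<tau> \<sigma> \<partial>lborel))"
        by (cases "\<sigma> \<ge> 0") (simp_all add: mult.assoc[symmetric])
    qed
    also have "\<dots> = ennreal (pi ^ Suc (Suc j) / fact j) * (\<integral>\<^sup>+\<sigma>. ennreal (\<sigma> ^ j) * indicator {0..} \<sigma> *
        (\<integral>\<^sup>+\<tau>. indicator {0..} \<tau> * \<Phi> \<tau> \<sigma> \<partial>lborel) \<partial>lborel)"
      by (rule nn_integral_cmult) measurable
    also have "(\<integral>\<^sup>+\<sigma>. ennreal (\<sigma> ^ j) * indicator {0..} \<sigma> * (\<integral>\<^sup>+\<tau>. indicator {0..} \<tau> * \<Phi> \<tau> \<sigma> \<partial>lborel) \<partial>lborel)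
        = ennreal (1 / (j + 2)) * (\<integral>\<^sup>+w. ennreal ((1 - w) ^ j) * indicator {0..1} w * h (s * w) \<partial>lborel)"
      unfolding \<Phi>_def using nn_integral_ratio[of "\<lambda>w. h (s * w)" j] by (simp add: add.commute)
    \<comment> \<open>The real dimension \<open>2 * (j + 2)\<close> from the cone definition of the
      surface measure cancels the factor from the radial integral.\<close>
    also have "of_nat (dim H) * (ennreal (pi ^ Suc (Suc j) / fact j) * (ennreal (1 / (j + 2)) *
          (\<integral>\<^sup>+w. ennreal ((1 - w) ^ j) * indicator {0..1} w * h (s * w) \<partial>lborel)))
        = ennreal (2 * pi ^ Suc (Suc j) / fact j) *
          (\<integral>\<^sup>+w. ennreal ((1 - w) ^ j) * indicator {0..1} w * h (s * w) \<partial>lborel)"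
    proof -
      have "of_nat (dim H) * ennreal (pi ^ Suc (Suc j) / fact j) * ennreal (1 / (j + 2))
          = ennreal (dim H * (pi ^ Suc (Suc j) / fact j) * (1 / (j + 2)))"
        by (simp only: ennreal_of_nat_eq_real_of_nat ennreal_mult[symmetric] pi_ge_zero
            zero_le_power zero_le_divide_iff fact_ge_zero of_nat_0_le_iff zero_le_one mult_nonneg_nonneg simp_thms)
      also have "dim H * (pi ^ Suc (Suc j) / fact j) * (1 / (j + 2)) = 2 * pi ^ Suc (Suc j) / fact j"
      proof -
        have "2 * y * (p / f) * (1 / y) = 2 * p / f" if "y \<noteq> 0" for y p f :: real
          using that by simp
        moreover have "real (dim H) = 2 * (real j + 2)" "real j + 2 \<noteq> 0" unfolding dim by simp_all
        ultimately show ?thesis by (metis of_nat_add of_nat_numeral)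
      qed
      finally show ?thesis by (simp add: mult.assoc[symmetric])
    qed
    finally show ?thesis unfolding k_def .
  qed
  with s show ?thesis using that by blast
qed

section \<open>Hyperbolic volume of sections of bodies of revolution\<close>

definition section_integral :: "nat \<Rightarrow> (real \<Rightarrow> real) \<Rightarrow> real \<Rightarrow> real" where
  "section_integral j \<omega> s =
     (LBINT w:{0..1}. (1 - w) ^ j * (1 / profile_fun \<omega> (s * w)) ^ (j + 2))"

text \<open>With \<open>m = j + 2\<close>: the factor \<open>8 ^ m\<close> of the volume, the
  constant of the sphere integral, and \<open>1 / (2 * m)\<close> from the radial integral.\<close>

definition section_constant :: "nat \<Rightarrow> real" where
  "section_constant j = 8 ^ (j + 2) * (2 * pi ^ (j + 2) / fact j) / (2 * (j + 2))"

lemma section_constant_pos: "0 < section_constant j"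
  by (simp add: section_constant_def)

lemma measurable_profile_fun[measurable]:
  assumes [measurable]: "\<omega> \<in> borel_measurable borel"
  shows "profile_fun \<omega> \<in> borel_measurable borel"
  unfolding profile_fun_def by measurable

text \<open>The number \<open>s\<close> is obtained before \<omega> is given, so the sections of two
  bodies by the same \<open>H\<close> are compared at the same \<open>s\<close>.\<close>

lemma hvol_profile_body:
  fixes H :: "(complex ^ 'n) set"
  assumes H: "vec.subspace H" and m: "vec.dim H = j + 2"
  obtains s where "0 \<le> s" "s \<le> 1" "H = UNIV \<Longrightarrow> s = 1"
    "\<And>\<omega>. profile \<omega> \<Longrightarrow> hvol H (profile_body i \<omega>)
       = section_constant j * section_integral j \<omega> s"
proof -
  obtain s where s: "0 \<le> s" "s \<le> 1" "H = UNIV \<Longrightarrow> s = 1" and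
    nn: "\<And>h. h \<in> borel_measurable borel \<Longrightarrow>
      (\<integral>\<^sup>+x. indicator (sphere 0 1 \<inter> H) x * h ((cmod (x $ i))\<^sup>2) \<partial>sphere_measure H)
      = ennreal (2 * pi ^ Suc (Suc j) / fact j) *
          (\<integral>\<^sup>+w. ennreal ((1 - w) ^ j) * indicator {0..1} w * h (s * w) \<partial>lborel)"
    using nn_integral_sphere_measure[OF H, of j i] m by auto
  have "hvol H (profile_body i \<omega>)
       = section_constant j * section_integral j \<omega> s"
    if "profile \<omega>" for \<omega>
  proof -
    have [measurable]: "\<omega> \<in> borel_measurable borel" using that by (simp add: profile_def)
    define M where "M = j + 2"
    define K where "K = 2 * pi ^ M / fact j"
    define g where "g v = (1 / profile_fun \<omega> v) ^ M / (2 * M)" for v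
    have g0: "0 \<le> g v" for v using profile_fun_ge_1[of \<omega> v] by (simp add: g_def)
    have [measurable]: "g \<in> borel_measurable borel" unfolding g_def by measurable
    have "closed (sphere 0 1 \<inter> H)"
      using closed_subspace[OF complex_subspace_imp_subspace[OF H]] by (intro closed_Int) auto
    then have [measurable]: "sphere 0 1 \<inter> H \<in> sets borel" by (rule borel_closed)
    have [measurable]: "(\<lambda>x :: complex ^ 'n. cmod (x $ i)) \<in> borel_measurable borel"
      by (intro borel_measurable_continuous_onI continuous_intros)
    have [simp, measurable_cong]: "sets (sphere_measure H) = sets borel"
      by (simp add: sphere_measure_def)
    have radial: "(LBINT r = 0..1 / minkowski_functional (profile_body i \<omega>) x. r ^ (2 * M - 1) / (1 - r\<^sup>2) ^ (M + 1))
        = g ((cmod (x $ i))\<^sup>2)" if "x \<in> sphere 0 1" for x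
      using radial_integral[of M "profile_fun \<omega> ((cmod (x $ i))\<^sup>2)"] that
        profile_fun_ge_1[of \<omega> "(cmod (x $ i))\<^sup>2"]
      by (simp add: minkowski_functional_profile_body g_def M_def)
    have "hvol H (profile_body i \<omega>)
        = 8 ^ M * (LINT x|sphere_measure H. indicator (sphere 0 1 \<inter> H) x * g ((cmod (x $ i))\<^sup>2))"
      unfolding hvol_def Let_def m M_def[symmetric] set_lebesgue_integral_def
    proof (intro arg_cong[of _ _ "\<lambda>x. 8 ^ M * x"] Bochner_Integration.integral_cong refl)
      fix x
      show "indicator (sphere 0 1 \<inter> H) x *\<^sub>R
          (LBINT r = 0..1 / minkowski_functional (profile_body i \<omega>) x. r ^ (2 * M - 1) / (1 - r\<^sup>2) ^ (M + 1))
        = indicator (sphere 0 1 \<inter> H) x * g ((cmod (x $ i))\<^sup>2)"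
        using radial[of x] by (cases "x \<in> sphere 0 1 \<inter> H") simp_all
    qed
    also have "(LINT x|sphere_measure H. indicator (sphere 0 1 \<inter> H) x * g ((cmod (x $ i))\<^sup>2))
        = enn2real (\<integral>\<^sup>+x. ennreal (indicator (sphere 0 1 \<inter> H) x * g ((cmod (x $ i))\<^sup>2)) \<partial>sphere_measure H)"
      by (rule integral_eq_nn_integral) (use g0 in auto)
    also have "(\<integral>\<^sup>+x. ennreal (indicator (sphere 0 1 \<inter> H) x * g ((cmod (x $ i))\<^sup>2)) \<partial>sphere_measure H)
        = (\<integral>\<^sup>+x. indicator (sphere 0 1 \<inter> H) x * ennreal (g ((cmod (x $ i))\<^sup>2)) \<partial>sphere_measure H)"
      by (intro nn_integral_cong) (simp split: split_indicator)
    also have "\<dots> = ennreal K * (\<integral>\<^sup>+w. ennreal ((1 - w) ^ j) * indicator {0..1} w * ennreal (g (s * w)) \<partial>lborel)"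
      by (subst nn) (simp_all add: K_def M_def)
    also have "(\<integral>\<^sup>+w. ennreal ((1 - w) ^ j) * indicator {0..1} w * ennreal (g (s * w)) \<partial>lborel)
        = (\<integral>\<^sup>+w. ennreal (indicator {0..1} w * ((1 - w) ^ j * g (s * w))) \<partial>lborel)"
      using g0 by (intro nn_integral_cong) (simp add: ennreal_mult split: split_indicator)
    also have "enn2real (ennreal K * (\<integral>\<^sup>+w. ennreal (indicator {0..1} w * ((1 - w) ^ j * g (s * w))) \<partial>lborel))
        = K * (LBINT w. indicator {0..1} w * ((1 - w) ^ j * g (s * w)))"
      unfolding enn2real_mult
      by (subst integral_eq_nn_integral) (use g0 in \<open>auto simp: K_def split: split_indicator\<close>)
    also have "(LBINT w. indicator {0..1} w * ((1 - w) ^ j * g (s * w)))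
        = (LBINT w. indicator {0..1} w * ((1 - w) ^ j * (1 / profile_fun \<omega> (s * w)) ^ M) / (2 * M))"
      by (simp add: g_def)
    also have "\<dots> = section_integral j \<omega> s / (2 * M)"
      unfolding section_integral_def set_lebesgue_integral_def M_def real_scaleR_def
      by (rule integral_divide_zero)
    finally show ?thesis unfolding K_def M_def section_constant_def by (simp only: times_divide_eq_right times_divide_eq_left mult.assoc)
  qed
  with s show ?thesis using that by blast
qed

section \<open>A compactly supported function with polynomial derivatives\<close>

lemma DERIV_max_0_power:
  fixes f :: "real \<Rightarrow> real"
  assumes f: "(f has_real_derivative D) (at t)" and k: "2 \<le> k"
  shows "((\<lambda>t. max 0 (f t) ^ k) has_real_derivative k * max 0 (f t) ^ (k - 1) * D) (at t)"
proof -
  have "((\<lambda>u :: real. max 0 u ^ k) has_real_derivative k * max 0 u ^ (k - 1)) (at u)" for u :: real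
  proof -
    consider (less) "u < 0" | (greater) "u > 0" | (equal) "u = 0" by linarith
    then show ?thesis
    proof cases
      case less
      have "((\<lambda>u :: real. 0) has_real_derivative 0) (at u)" by simp
      then have "((\<lambda>u :: real. max 0 u ^ k) has_real_derivative 0) (at u)"
        by (rule has_field_derivative_transform_within_open[of _ _ _ "{..<0}"])
           (use less k in \<open>auto simp: max_def\<close>)
      then show ?thesis using less k by (simp add: max_def power_0_left)
    next
      case greater
      have "((\<lambda>u :: real. u ^ k) has_real_derivative k * u ^ (k - 1)) (at u)"
        by (auto intro!: derivative_eq_intros)
      then have "((\<lambda>u :: real. max 0 u ^ k) has_real_derivative k * u ^ (k - 1)) (at u)"
        by (rule has_field_derivative_transform_within_open[of _ _ _ "{0<..}"])
           (use greater in \<open>auto simp: max_def\<close>)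
      then show ?thesis using greater by (simp add: max_def)
    next
      case equal
      \<comment> \<open>At the kink the difference quotient is at most
        \<open>\<bar>h\<bar> ^ (k - 1)\<close>, which tends to 0 because
        \<open>k \<ge> 2\<close>.\<close>
      have "((\<lambda>h :: real. max 0 h ^ k / h) \<longlongrightarrow> 0) (at 0)"
      proof (rule Lim_null_comparison)
        have "norm (max 0 h ^ k / h) \<le> \<bar>h\<bar> ^ (k - 1)" if "h \<noteq> 0" for h :: real
        proof (cases "h > 0")
          case True
          have "h ^ k = h * h ^ (k - 1)" using k by (simp add: power_eq_if)
          then show ?thesis using True by (simp add: max_def)
        qed (use k in \<open>auto simp: max_def power_0_left\<close>)
        then show "eventually (\<lambda>h :: real. norm (max 0 h ^ k / h) \<le> \<bar>h\<bar> ^ (k - 1)) (at 0)"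
          by (auto simp: eventually_at intro: exI[of _ 1])
        show "((\<lambda>h :: real. \<bar>h\<bar> ^ (k - 1)) \<longlongrightarrow> 0) (at 0)"
          by (intro tendsto_null_power tendsto_rabs_zero tendsto_ident_at) (use k in auto)
      qed
      then show ?thesis using k equal unfolding DERIV_def by (simp add: power_0_left)
    qed
  qed
  from DERIV_chain2[OF this f] show ?thesis by simp
qed

text \<open>The product rule for \<open>P * \<phi> ^ (N - j)\<close> with
  \<open>\<phi> = (t - 1) * (2 - t)\<close>: one factor \<phi> is lost and the rest is collected in
  the polynomial.\<close>

primrec bump_poly :: "nat \<Rightarrow> nat \<Rightarrow> real poly" where
  "bump_poly N 0 = 1"
| "bump_poly N (Suc j) = pderiv (bump_poly N j) * [:-2, 3, -1:]
     + smult (of_nat (N - j)) (bump_poly N j * pderiv [:-2, 3, -1:])"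

text \<open>The \<open>j\<close>-th derivative of \<open>max 0 ((t - 1) * (2 - t)) ^ N\<close>.\<close>

definition bump :: "nat \<Rightarrow> nat \<Rightarrow> real \<Rightarrow> real" where
  "bump N j t = poly (bump_poly N j) t * max 0 (poly [:-2, 3, -1:] t) ^ (N - j)"

lemma bump_quadratic: "poly [:-2, 3, -1:] t = (t - 1) * (2 - t :: real)"
  by (simp add: algebra_simps)

lemma DERIV_bump:
  assumes "j + 2 \<le> N"
  shows "(bump N j has_real_derivative bump N (Suc j) t) (at t)"
proof -
  define \<phi> :: "real poly" where "\<phi> = [:-2, 3, -1:]"
  let ?m = "max 0 (poly \<phi> t)" and ?P = "bump_poly N j"
  have "((\<lambda>t. poly ?P t * max 0 (poly \<phi> t) ^ (N - j)) has_real_derivative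
      poly (pderiv ?P) t * ?m ^ (N - j)
        + (N - j) * ?m ^ (N - j - 1) * poly (pderiv \<phi>) t * poly ?P t) (at t)"
    using assms by (intro DERIV_mult DERIV_max_0_power poly_DERIV) auto
  also have "(\<lambda>t. poly ?P t * max 0 (poly \<phi> t) ^ (N - j)) = bump N j"
    by (simp add: bump_def fun_eq_iff \<phi>_def)
  also have "poly (pderiv ?P) t * ?m ^ (N - j) + (N - j) * ?m ^ (N - j - 1) * poly (pderiv \<phi>) t * poly ?P t
      = bump N (Suc j) t"
  proof -
    obtain k where k: "N - j = Suc (Suc k)" using assms by (intro that[of "N - j - 2"]) auto
    then have k': "N - Suc j = Suc k" "N - j - 1 = Suc k" by auto
    \<comment> \<open>Where the quadratic is negative both sides vanish, so one truncated factor may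
      be replaced by the polynomial.\<close>
    have m: "?m ^ Suc (Suc k) = poly \<phi> t * ?m ^ Suc k"
      by (cases "0 \<le> poly \<phi> t") (simp_all add: max_def)
    show ?thesis
      unfolding bump_def bump_poly.simps poly_add poly_mult poly_smult \<phi>_def[symmetric] k' k m
      by (simp only: algebra_simps diff_Suc_1)
  qed
  finally show ?thesis .
qed

lemma bump_eq_0:
  assumes "j < N" "t \<le> 1 \<or> 2 \<le> t"
  shows "bump N j t = 0"
proof -
  have "(t - 1) * (2 - t) \<le> 0"
    using assms(2) by (auto simp: mult_le_0_iff)
  then show ?thesis using assms(1) unfolding bump_def bump_quadratic by simp
qed

lemma continuous_on_bump: "continuous_on A (bump N j)"
  unfolding bump_def by (intro continuous_intros)

lemma bump_0_nonneg: "0 \<le> bump N 0 t"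
  by (simp add: bump_def)

lemma bump_0_pos: "1 < t \<Longrightarrow> t < 2 \<Longrightarrow> 0 < bump N 0 t"
  unfolding bump_def bump_quadratic by simp

text \<open>Continuity on the compact interval from 1 to 2 and vanishing outside it. One bound for
  all orders lets one \<delta> control several derivatives.\<close>

lemma bump_bounded: "\<exists>M\<ge>0. \<forall>j<N. \<forall>t. \<bar>bump N j t\<bar> \<le> M"
proof -
  have "\<exists>M\<ge>0. \<forall>t\<in>{1..2}. \<bar>bump N j t\<bar> \<le> M" for j
  proof -
    have "bounded (bump N j ` {1..2})"
      by (intro compact_imp_bounded compact_continuous_image continuous_on_bump) auto
    then show ?thesis unfolding bounded_pos by (auto intro: less_imp_le)
  qed
  then obtain M where M: "\<And>j. 0 \<le> M j" "\<And>j t. t \<in> {1..2} \<Longrightarrow> \<bar>bump N j t\<bar> \<le> M j" by metis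
  have "\<bar>bump N j t\<bar> \<le> (\<Sum>j<N. M j)" if "j < N" for j t
  proof (cases "t \<in> {1..2}")
    case True
    then have "\<bar>bump N j t\<bar> \<le> M j" by (rule M(2))
    also have "\<dots> \<le> (\<Sum>j<N. M j)" using that M(1) by (intro member_le_sum) auto
    finally show ?thesis .
  next
    case False
    then have "bump N j t = 0" using that by (intro bump_eq_0) auto
    then show ?thesis using M(1) by (simp add: sum_nonneg)
  qed
  moreover have "0 \<le> (\<Sum>j<N. M j)" using M(1) by (simp add: sum_nonneg)
  ultimately show ?thesis by blast
qed

lemma has_integral_DERIV:
  fixes F :: "real \<Rightarrow> real"
  assumes "a \<le> b" "\<And>t. (F has_real_derivative f t) (at t)"
  shows "(f has_integral F b - F a) {a..b}"
proof (rule fundamental_theorem_of_calculus[OF assms(1)])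
  show "(F has_vector_derivative f t) (at t within {a..b})" for t
    using assms(2) unfolding has_real_derivative_iff_has_vector_derivative
    by (rule has_vector_derivative_at_within)
qed

text \<open>Integration by parts \<open>i\<close> times, followed by one exact integration. Boundary
  terms vanish at 1 because of the bump, and at \<open>T\<close> because of either the bump or the
  factor \<open>1 - a * T\<close>.\<close>

lemma has_integral_bump_power:
  assumes "i + 2 \<le> N" "1 \<le> T" and T: "(\<forall>j<N. bump N j T = 0) \<or> a * T = 1"
  shows "((\<lambda>t. bump N (Suc i) t * (1 - a * t) ^ i) has_integral fact i * a ^ i * bump N 0 T) {1..T}"
  using assms(1)
proof (induction i)
  case 0
  have "(bump N (Suc 0) has_integral bump N 0 T - bump N 0 1) {1..T}"
    using 0 assms(2)
    by (intro has_integral_DERIV DERIV_bump) auto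
  then show ?case using 0 by (simp add: bump_eq_0)
next
  case (Suc i)
  define H where "H t = bump N (Suc i) t * (1 - a * t) ^ Suc i" for t
  have "(H has_real_derivative bump N (Suc (Suc i)) t * (1 - a * t) ^ Suc i
      - Suc i * a * (bump N (Suc i) t * (1 - a * t) ^ i)) (at t)" for t
    unfolding H_def using Suc.prems
    by (auto intro!: derivative_eq_intros DERIV_bump simp del: power_Suc of_nat_Suc simp: algebra_simps)
  then have "((\<lambda>t. bump N (Suc (Suc i)) t * (1 - a * t) ^ Suc i
      - Suc i * a * (bump N (Suc i) t * (1 - a * t) ^ i)) has_integral H T - H 1) {1..T}"
    using assms(2)
    by (intro has_integral_DERIV) auto
  moreover have "H T = 0" "H 1 = 0"
    using T Suc.prems by (auto simp: H_def bump_eq_0)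
  moreover have "((\<lambda>t. bump N (Suc i) t * (1 - a * t) ^ i) has_integral fact i * a ^ i * bump N 0 T) {1..T}"
    using Suc by simp
  ultimately have "((\<lambda>t. (bump N (Suc (Suc i)) t * (1 - a * t) ^ Suc i
      - Suc i * a * (bump N (Suc i) t * (1 - a * t) ^ i)) + Suc i * a * (bump N (Suc i) t * (1 - a * t) ^ i))
      has_integral 0 + Suc i * a * (fact i * a ^ i * bump N 0 T)) {1..T}"
    by (intro has_integral_add has_integral_mult_right) auto
  then show ?case by (simp add: mult_ac)
qed

text \<open>Each integration by parts moves a derivative to \<open>exp (- t)\<close>; its sign and
  the sign of that derivative cancel.\<close>

lemma has_integral_bump_exp:
  assumes "j < N"
  shows "((\<lambda>t. bump N j t * exp (- t)) has_integral integral {1..2} (\<lambda>t. bump N 0 t * exp (- t))) {1..2}"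
  using assms
proof (induction j)
  case 0
  show ?case
    by (intro integrable_integral integrable_continuous_interval continuous_intros continuous_on_bump)
next
  case (Suc j)
  define H where "H t = bump N j t * exp (- t)" for t
  have "(H has_real_derivative bump N (Suc j) t * exp (- t) - bump N j t * exp (- t)) (at t)" for t
    unfolding H_def using Suc.prems
    by (auto intro!: derivative_eq_intros DERIV_bump)
  then have "((\<lambda>t. bump N (Suc j) t * exp (- t) - bump N j t * exp (- t)) has_integral H 2 - H 1) {1..2}"
    by (intro has_integral_DERIV) auto
  moreover have "H 2 = 0" "H 1 = 0" using Suc.prems by (auto simp: H_def bump_eq_0)
  moreover have "((\<lambda>t. bump N j t * exp (- t)) has_integral integral {1..2} (\<lambda>t. bump N 0 t * exp (- t))) {1..2}"
    using Suc by simp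
  ultimately have "((\<lambda>t. (bump N (Suc j) t * exp (- t) - bump N j t * exp (- t)) + bump N j t * exp (- t))
      has_integral 0 + integral {1..2} (\<lambda>t. bump N 0 t * exp (- t))) {1..2}"
    by (intro has_integral_add) auto
  then show ?case by simp
qed

lemma integral_bump_exp_pos: "0 < integral {1..2} (\<lambda>t. bump N 0 t * exp (- t))"
proof -
  let ?f = "\<lambda>t. bump N 0 t * exp (- t)"
  have cont: "continuous_on {1..2} ?f" by (intro continuous_intros continuous_on_bump)
  then have int: "?f integrable_on {1..2}" by (rule integrable_continuous_interval)
  have "integral {1..2} ?f \<ge> 0"
    by (rule integral_nonneg[OF int]) (simp add: bump_0_nonneg)
  moreover have "integral {1..2} ?f \<noteq> 0"
  proof
    assume "integral {1..2} ?f = 0"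
    then have "(?f has_integral 0) (cbox 1 2)" using int by (simp add: has_integral_iff)
    then have "?f (3 / 2) = 0"
      by (rule has_integral_0_cbox_imp_0[rotated 2]) (use cont in \<open>auto simp: bump_0_nonneg\<close>)
    then show False using bump_0_pos[of "3 / 2" N] by simp
  qed
  ultimately show ?thesis by linarith
qed

section \<open>The two profiles\<close>

text \<open>Used with \<open>p = - 1 / m\<close> to find supporting lines of the profiles and with
  \<open>p = n / m\<close> to bound the volume difference from below.\<close>

lemma powr_above_tangent:
  fixes u v p :: real
  assumes "0 < u" "0 < v" "p \<le> 0 \<or> 1 \<le> p"
  shows "u powr p + p * u powr (p - 1) * (v - u) \<le> v powr p"
proof -
  have "convex_on {0<..} (\<lambda>x :: real. x powr p)"
  proof (rule f''_ge0_imp_convex)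
    show "((\<lambda>x. x powr p) has_real_derivative p * x powr (p - 1)) (at x)" if "x \<in> {0<..}" for x
      using that by (auto intro!: derivative_eq_intros)
    show "((\<lambda>x. p * x powr (p - 1)) has_real_derivative p * ((p - 1) * x powr (p - 1 - 1))) (at x)"
      if "x \<in> {0<..}" for x
      using that by (intro DERIV_cmult) (auto intro!: derivative_eq_intros)
    have "0 \<le> p * (p - 1)" using assms(3) by (auto simp: zero_le_mult_iff)
    then show "0 \<le> p * ((p - 1) * x powr (p - 1 - 1))" for x
      by (metis mult.assoc mult_nonneg_nonneg powr_ge_zero)
  qed simp
  moreover have "((\<lambda>x. x powr p) has_real_derivative p * u powr (p - 1)) (at u within {0<..})"
    using assms(1) by (auto intro!: derivative_eq_intros)
  ultimately have "v powr p - u powr p \<ge> p * u powr (p - 1) * (v - u)"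
    using assms by (intro convex_on_imp_above_tangent[of "{0<..}"]) (auto simp: interior_open)
  then show ?thesis by linarith
qed

text \<open>The power -m of the profile is affine in \<open>F\<close>, so differences of
  \<open>m\<close>-dimensional sections are exactly linear in the perturbation. The factor 4 makes
  the tube term exceed 1 for \<open>v \<le> 1 / 2\<close> when \<open>F\<close> has values between 0
  and 1.\<close>

definition power_profile :: "real \<Rightarrow> nat \<Rightarrow> (real \<Rightarrow> real) \<Rightarrow> real \<Rightarrow> real" where
  "power_profile \<epsilon> m F t = 4 * (1 - \<epsilon> * F t) powr (- 1 / m)"

text \<open>\<open>y \<mapsto> (1 - \<epsilon> y) powr (- 1 / m)\<close> is convex and increasing, so it preserves convexity of \<open>F\<close>.\<close>

lemma profile_power_profile:
  fixes F F' F'' :: "real \<Rightarrow> real"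
  assumes \<epsilon>: "0 < \<epsilon>" "\<epsilon> \<le> 1 / 80" and m: "1 \<le> m"
    and F: "\<And>t. (F has_real_derivative F' t) (at t)" "\<And>t. (F' has_real_derivative F'' t) (at t)"
    and F'': "\<And>t. 0 \<le> F'' t"
    and F': "\<And>t. 1 \<le> t \<Longrightarrow> - 1 \<le> F' t" "\<And>t. 1 \<le> t \<Longrightarrow> F' t \<le> 0"
    and F1: "\<And>t. 1 \<le> t \<Longrightarrow> F t \<le> 1"
  shows "profile (power_profile \<epsilon> m F)"
  unfolding profile_def
proof (intro conjI allI impI)
  have "continuous_on UNIV F" using F(1) by (meson DERIV_isCont continuous_at_imp_continuous_on)
  then have [measurable]: "F \<in> borel_measurable borel" by (rule borel_measurable_continuous_onI)
  show "power_profile \<epsilon> m F \<in> borel_measurable borel" unfolding power_profile_def by measurable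
  show "0 \<le> power_profile \<epsilon> m F t" for t by (simp add: power_profile_def)
  fix t :: real assume t: "1 \<le> t"
  define p where "p = - 1 / real m"
  have p: "- 1 \<le> p" "p < 0" using m by (auto simp: p_def field_simps)
  define u where "u s = 1 - \<epsilon> * F s" for s
  have u: "1 / 2 \<le> u s" if "1 \<le> s" for s
  proof -
    have "\<epsilon> * F s \<le> \<epsilon> * 1" using F1[OF that] \<epsilon> by (intro mult_left_mono) auto
    then show ?thesis unfolding u_def using \<epsilon> by linarith
  qed
  \<comment> \<open>The derivative of the outer function at \<open>F t\<close>. Since
    \<open>u t \<ge> 1 / 2\<close> and \<open>p - 1 \<ge> - 2\<close>, the power is at most 4, and
    \<open>4 * 4 / 80 = 1 / 5\<close> explains the bound on \<epsilon>.\<close>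
  define c where "c = 4 * (- p * \<epsilon>) * u t powr (p - 1)"
  have "u t powr (p - 1) \<le> (1 / 2) powr (p - 1)" using u[OF t] p by (intro powr_mono2') auto
  also have "\<dots> \<le> (1 / 2) powr (- 2)" using p by (intro powr_mono') auto
  also have "\<dots> = 4" by (simp add: powr_minus_divide power_divide)
  finally have "(- p * \<epsilon>) * u t powr (p - 1) \<le> (1 / 80) * 4"
  proof (intro mult_mono)
    have "- p * \<epsilon> \<le> 1 * \<epsilon>" using p \<epsilon> by (intro mult_right_mono) auto
    then show "- p * \<epsilon> \<le> 1 / 80" using \<epsilon> by simp
  qed auto
  moreover have "0 \<le> (- p * \<epsilon>) * u t powr (p - 1)"
    using p \<epsilon> by (intro mult_nonneg_nonneg) auto
  moreover have "c = 4 * ((- p * \<epsilon>) * u t powr (p - 1))" by (simp add: c_def)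
  ultimately have c: "0 \<le> c" "c \<le> 1 / 5" by linarith+
  show "\<exists>d. - 1 / 5 \<le> d \<and> d \<le> 0 \<and>
      (\<forall>s\<ge>1. power_profile \<epsilon> m F t + d * (s - t) \<le> power_profile \<epsilon> m F s)"
  proof (intro exI[of _ "c * F' t"] conjI allI impI)
    have "c * - F' t \<le> (1 / 5) * 1" using c F'[OF t] by (intro mult_mono) auto
    then show "- 1 / 5 \<le> c * F' t" by simp
    show "c * F' t \<le> 0" using c F'[OF t] by (simp add: mult_nonneg_nonpos)
    fix s :: real assume s: "1 \<le> s"
    have "convex_on UNIV F" using F F'' by (intro f''_ge0_imp_convex) auto
    then have "F s - F t \<ge> F' t * (s - t)"
      using F(1) by (intro convex_on_imp_above_tangent[of UNIV]) auto
    then have "c * (F' t * (s - t)) \<le> c * (F s - F t)" using c by (intro mult_left_mono)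
    also have "\<dots> = 4 * (p * u t powr (p - 1) * (u s - u t))"
      by (simp add: c_def u_def algebra_simps)
    also have "\<dots> \<le> 4 * (u s powr p - u t powr p)"
      using powr_above_tangent[of "u t" "u s" p] u[OF t] u[OF s] p by simp
    finally show "power_profile \<epsilon> m F t + c * F' t * (s - t) \<le> power_profile \<epsilon> m F s"
      by (simp add: power_profile_def u_def p_def algebra_simps)
  qed
qed

text \<open>For \<open>v \<le> 1 / 2\<close> the maximum in \<open>profile_fun\<close> is attained
  by the tube term, so the power can be computed explicitly.\<close>

lemma profile_fun_power_profile:
  assumes \<epsilon>: "0 < \<epsilon>" "\<epsilon> \<le> 1 / 80" and v: "0 \<le> v" "v \<le> 1 / 2"
    and F: "0 \<le> F (1 / (1 - v))" "F (1 / (1 - v)) \<le> 1" and "1 \<le> m"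
  shows "(1 / profile_fun (power_profile \<epsilon> m F) v) ^ k
    = (1 / (1 - v)) ^ k / 4 ^ k * (1 - \<epsilon> * F (1 / (1 - v))) powr (k / m)"
proof -
  define u where "u = 1 - \<epsilon> * F (1 / (1 - v))"
  have "\<epsilon> * F (1 / (1 - v)) \<le> \<epsilon> * 1" using F \<epsilon> by (intro mult_left_mono) auto
  moreover have "0 \<le> \<epsilon> * F (1 / (1 - v))" using F \<epsilon> by simp
  ultimately have u: "0 < u" "u \<le> 1" unfolding u_def using \<epsilon> by linarith+
  have "1 \<le> u powr (- 1 / m)" using u assms by (simp add: powr_minus_divide divide_simps powr_le1)
  then have "(1 / 4) * 4 * 1 \<le> (1 - v) * 4 * u powr (- 1 / m)"
    using v by (intro mult_mono) auto
  then have "1 \<le> (1 - v) * 4 * u powr (- 1 / m)" by linarith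
  moreover have "profile_fun (power_profile \<epsilon> m F) v = max 1 ((1 - v) * 4 * u powr (- 1 / m))"
    unfolding profile_fun_def power_profile_def u_def by (simp only: mult.assoc)
  ultimately have Q: "profile_fun (power_profile \<epsilon> m F) v = (1 - v) * 4 * u powr (- 1 / m)"
    by (simp only: max.absorb2)
  have "(1 / u powr (- 1 / m)) ^ k = u powr (k / m)"
    using u by (simp add: powr_minus_divide powr_power mult.commute)
  moreover have "(1 / (a * 4 * X)) ^ k = (1 / a) ^ k / 4 ^ k * (1 / X) ^ k" for a X :: real
    by (simp add: power_divide power_mult_distrib)
  ultimately show ?thesis unfolding Q u_def[symmetric] by (simp only:)
qed

lemma profile_fun_power_profile_cong:
  assumes "\<And>t. 2 \<le> t \<Longrightarrow> F t = G t" "1 / 2 \<le> v" "v \<le> 1"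
  shows "profile_fun (power_profile \<epsilon> m F) v = profile_fun (power_profile \<epsilon> m G) v"
proof (cases "v = 1")
  case False
  then have "2 \<le> 1 / (1 - v)" using assms by (simp add: field_simps)
  then show ?thesis using assms(1) by (simp add: profile_fun_def power_profile_def)
qed (simp add: profile_fun_def)

section \<open>Section integrals and the change to the tube parameter\<close>

lemma section_integrand_integrable:
  assumes "profile \<omega>" "0 \<le> s" "s \<le> 1"
  shows "set_integrable lborel {0..1} (\<lambda>w. (1 - w) ^ j * (1 / profile_fun \<omega> (s * w)) ^ (j + 2))"
    (is "set_integrable _ _ ?f")
proof (rule set_integrable_bound)
  show "set_integrable lborel {0..1 :: real} (\<lambda>_. 1 :: real)"
    by (auto simp: set_integrable_def intro!: integrable_real_indicator)
  have [measurable]: "\<omega> \<in> borel_measurable borel" using assms by (simp add: profile_def)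
  show "set_borel_measurable lborel {0..1} ?f" unfolding set_borel_measurable_def by measurable
  show "AE x in lborel. x \<in> {0..1} \<longrightarrow> norm (?f x) \<le> norm (1 :: real)"
  proof (intro AE_I2 impI)
    fix x :: real assume "x \<in> {0..1}"
    then have x: "0 \<le> 1 - x" "1 - x \<le> 1" by auto
    have Q: "0 \<le> 1 / profile_fun \<omega> (s * x)" "1 / profile_fun \<omega> (s * x) \<le> 1"
      using profile_fun_ge_1[of \<omega> "s * x"] by auto
    have "0 \<le> ?f x" using x Q by (intro mult_nonneg_nonneg zero_le_power)
    moreover have "?f x \<le> 1" using x Q by (intro mult_le_one zero_le_power power_le_one)
    ultimately show "norm (?f x) \<le> norm (1 :: real)" by simp
  qed
qed

lemma section_integral_diff:
  assumes "profile \<omega>1" "profile \<omega>2" "0 \<le> s" "s \<le> 1"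
  shows "((\<lambda>w. (1 - w) ^ j * ((1 / profile_fun \<omega>1 (s * w)) ^ (j + 2) - (1 / profile_fun \<omega>2 (s * w)) ^ (j + 2)))
    has_integral section_integral j \<omega>1 s - section_integral j \<omega>2 s) {0..1}"
proof -
  let ?f = "\<lambda>\<omega> w. (1 - w) ^ j * (1 / profile_fun \<omega> (s * w)) ^ (j + 2)"
  have "(?f \<omega> has_integral section_integral j \<omega> s) {0..1}" if "profile \<omega>" for \<omega>
    using set_borel_integral_eq_integral[OF section_integrand_integrable[OF that assms(3,4), of j]]
    unfolding section_integral_def by (simp add: has_integral_iff)
  from has_integral_diff[OF this this, OF assms(1,2)] show ?thesis
    by (simp add: right_diff_distrib)
qed

text \<open>The substitution \<open>w = (1 - 1 / t) / s\<close>, inverse to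
  \<open>t = 1 / (1 - s * w)\<close>.\<close>

lemma has_integral_tube_substitution:
  fixes f :: "real \<Rightarrow> real"
  assumes s: "0 < s" and T: "1 \<le> T" and f: "continuous_on {0..(1 - 1 / T) / s} f"
  shows "((\<lambda>t. 1 / (s * t\<^sup>2) * f ((1 - 1 / t) / s)) has_integral integral {0..(1 - 1 / T) / s} f) {1..T}"
proof -
  have "((\<lambda>t. (1 / (s * t\<^sup>2)) *\<^sub>R f ((1 - 1 / t) / s)) has_integral
      integral {(1 - 1 / 1) / s..(1 - 1 / T) / s} f) {1..T}"
  proof (rule has_integral_substitution[OF T _ _ f])
    show "(1 - 1 / 1) / s \<le> (1 - 1 / T) / s" using s T by simp
    show "(\<lambda>t. (1 - 1 / t) / s) ` {1..T} \<subseteq> {0..(1 - 1 / T) / s}"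
    proof safe
      fix t assume t: "t \<in> {1..T}"
      then have "1 / T \<le> 1 / t" by (simp add: frac_le)
      then have "(1 - 1 / t) / s \<le> (1 - 1 / T) / s" using s by (simp add: divide_right_mono)
      moreover have "0 \<le> (1 - 1 / t) / s" using t s by simp
      ultimately show "(1 - 1 / t) / s \<in> {0..(1 - 1 / T) / s}" by (simp only: atLeastAtMost_iff)
    qed
    show "((\<lambda>t. (1 - 1 / t) / s) has_field_derivative 1 / (s * t\<^sup>2)) (at t within {1..T})"
      if "t \<in> {1..T}" for t
      using that s by (auto intro!: derivative_eq_intros simp: power2_eq_square)
  qed
  then show ?thesis by simp
qed

section \<open>The perturbed exponential and the sign of its effects\<close>

text \<open>For \<open>m = i + 2\<close> the perturbation is the derivative of order
  \<open>m - 1\<close>, and the exponent \<open>i + 4\<close> leaves two further derivatives for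
  checking convexity.\<close>

definition perturbed_exp :: "nat \<Rightarrow> real \<Rightarrow> real \<Rightarrow> real" where
  "perturbed_exp i \<delta> t = exp (- t) + \<delta> * bump (i + 4) (i + 1) t"

lemma perturbed_exp_eq: "2 \<le> t \<Longrightarrow> perturbed_exp i \<delta> t = exp (- t)"
  by (simp add: perturbed_exp_def bump_eq_0)

lemma perturbed_exp_0: "perturbed_exp i 0 = (\<lambda>t. exp (- t))"
  by (simp add: perturbed_exp_def fun_eq_iff)

text \<open>A uniform bound \<open>exp (- 2)\<close> suffices for domination by
  \<open>exp (- t)\<close>, because the bump vanishes beyond 2.\<close>

lemma perturbation_small:
  obtains \<delta> where "0 < \<delta>" "\<And>j t. j < i + 4 \<Longrightarrow> \<bar>\<delta> * bump (i + 4) j t\<bar> \<le> exp (- 2)"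
    "\<And>j t. j < i + 4 \<Longrightarrow> \<bar>\<delta> * bump (i + 4) j t\<bar> \<le> exp (- t)"
proof -
  obtain M where M: "0 \<le> M" "\<And>j t. j < i + 4 \<Longrightarrow> \<bar>bump (i + 4) j t\<bar> \<le> M"
    using bump_bounded by metis
  define \<delta> :: real where "\<delta> = exp (- 2) / (M + 1)"
  have \<delta>: "0 < \<delta>" "\<delta> * M \<le> exp (- 2)" using M(1) by (auto simp: \<delta>_def field_simps)
  have b: "\<bar>\<delta> * bump (i + 4) j t\<bar> \<le> exp (- 2)" if "j < i + 4" for j t
  proof -
    have "\<bar>\<delta> * bump (i + 4) j t\<bar> \<le> \<delta> * M"
      unfolding abs_mult using \<delta>(1) M(2)[OF that] by (simp add: mult_left_mono)
    then show ?thesis using \<delta>(2) by linarith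
  qed
  moreover have "\<bar>\<delta> * bump (i + 4) j t\<bar> \<le> exp (- t)" if "j < i + 4" for j t
  proof (cases "t \<le> 2")
    case True
    then have "exp (- 2) \<le> exp (- t)" by simp
    then show ?thesis using b[OF that, of t] by linarith
  next
    case False
    then show ?thesis using that by (simp add: bump_eq_0)
  qed
  ultimately show ?thesis using that \<delta>(1) by blast
qed

lemma exp_minus_le_half: "1 \<le> t \<Longrightarrow> exp (- t) \<le> (1 / 2 :: real)"
proof -
  assume "1 \<le> t"
  then have "2 \<le> exp t" using exp_ge_add_one_self[of t] by linarith
  then show ?thesis by (simp add: exp_minus field_simps)
qed

lemma perturbed_exp_bounds:
  assumes \<delta>: "\<And>j t. j < i + 4 \<Longrightarrow> \<bar>\<delta> * bump (i + 4) j t\<bar> \<le> exp (- 2)"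
    "\<And>j t. j < i + 4 \<Longrightarrow> \<bar>\<delta> * bump (i + 4) j t\<bar> \<le> exp (- t)" and t: "1 \<le> t"
  shows "0 \<le> perturbed_exp i \<delta> t" "perturbed_exp i \<delta> t \<le> 1"
  using \<delta>(1)[of "i + 1" t] \<delta>(2)[of "i + 1" t] exp_minus_le_half[OF t] exp_minus_le_half[of 2]
  unfolding perturbed_exp_def by (simp_all add: abs_le_iff)

text \<open>Domination by \<open>exp (- t)\<close> keeps the first derivative nonpositive and the
  second nonnegative; \<open>exp (- t) \<le> 1 / 2\<close> keeps the first above -1. The case
  \<open>\<delta> = 0\<close> gives the profile of \<open>L\<close>.\<close>

lemma profile_perturbed_exp:
  assumes \<epsilon>: "0 < \<epsilon>" "\<epsilon> \<le> 1 / 80" and m: "1 \<le> m"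
    and \<delta>: "\<And>j t. j < i + 4 \<Longrightarrow> \<bar>\<delta> * bump (i + 4) j t\<bar> \<le> exp (- 2)"
    "\<And>j t. j < i + 4 \<Longrightarrow> \<bar>\<delta> * bump (i + 4) j t\<bar> \<le> exp (- t)"
  shows "profile (power_profile \<epsilon> m (perturbed_exp i \<delta>))"
proof (rule profile_power_profile[OF \<epsilon> m])
  let ?F' = "\<lambda>t. - exp (- t) + \<delta> * bump (i + 4) (i + 2) t"
  let ?F'' = "\<lambda>t. exp (- t) + \<delta> * bump (i + 4) (i + 3) t"
  have s: "Suc (i + 1) = i + 2" "Suc (i + 2) = i + 3" by simp_all
  have d: "(bump (i + 4) (i + 1) has_real_derivative bump (i + 4) (i + 2) t) (at t)"
      "(bump (i + 4) (i + 2) has_real_derivative bump (i + 4) (i + 3) t) (at t)" for t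
    using DERIV_bump[of "i + 1" "i + 4" t] DERIV_bump[of "i + 2" "i + 4" t] unfolding s by auto
  have e: "((\<lambda>t. exp (- t)) has_real_derivative - exp (- t)) (at t)" for t :: real
    by (auto intro!: derivative_eq_intros)
  show "(perturbed_exp i \<delta> has_real_derivative ?F' t) (at t)" for t
    unfolding perturbed_exp_def[abs_def] by (rule DERIV_add[OF e DERIV_cmult[OF d(1)]])
  show "(?F' has_real_derivative ?F'' t) (at t)" for t
    using DERIV_add[OF DERIV_minus[OF e] DERIV_cmult[OF d(2)]] by simp
  show "0 \<le> ?F'' t" for t using \<delta>(2)[of "i + 3" t] by (simp add: abs_le_iff)
  show "?F' t \<le> 0" for t using \<delta>(2)[of "i + 2" t] by (simp add: abs_le_iff)
  show "- 1 \<le> ?F' t" if "1 \<le> t" for t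
    using \<delta>(2)[of "i + 2" t] exp_minus_le_half[OF that] by (simp add: abs_le_iff)
  show "perturbed_exp i \<delta> t \<le> 1" if "1 \<le> t" for t
    using perturbed_exp_bounds(2)[OF \<delta> that] .
qed

text \<open>To first order in \<open>\<epsilon>\<close> the integral is \<open>- \<alpha> \<epsilon>\<close> times the integral of \<open>bump N (i + 1) t * exp (- t)\<close>,
  and the zeroth order term vanishes.\<close>

lemma integral_bump_powr_neg:
  assumes "0 < \<alpha>" and N: "i + 2 \<le> N"
  obtains \<epsilon> where "0 < \<epsilon>" "\<epsilon> \<le> 1 / 80"
    "integral {1..2} (\<lambda>t. bump N (i + 1) t * (1 - \<epsilon> * exp (- t)) powr \<alpha>) < 0"
proof -
  define g where "g = bump N (i + 1)"
  define P where "P = integral {1..2} (\<lambda>t. bump N 0 t * exp (- t))"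
  have P: "0 < P" unfolding P_def by (rule integral_bump_exp_pos)
  obtain M where M: "0 \<le> M" "\<And>t. \<bar>g t\<bar> \<le> M"
    using bump_bounded[of N] N unfolding g_def by (metis Suc_eq_plus1 Suc_le_lessD add_2_eq_Suc')
  \<comment> \<open>The zeroth order term: \<open>a = 0\<close> and \<open>T = 2\<close> in the
    power formula, where the undifferentiated bump vanishes at 2.\<close>
  have ig: "(g has_integral 0) {1..2}"
    using has_integral_bump_power[of i N 2 0] N by (cases i) (auto simp: g_def bump_eq_0)
  have igf: "((\<lambda>t. g t * exp (- t)) has_integral P) {1..2}"
    unfolding g_def P_def by (rule has_integral_bump_exp) (use N in simp)
  \<comment> \<open>Chosen so that the total remainder \<open>M * \<eta> * \<epsilon>\<close> stays
    below half of the first order gain \<open>\<alpha> * \<epsilon> * P\<close>.\<close>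
  define \<eta> where "\<eta> = \<alpha> * P / (2 * (M + 1))"
  have \<eta>: "0 < \<eta>" using assms(1) P M(1) by (simp add: \<eta>_def)
  have "((\<lambda>y :: real. (1 - y) powr \<alpha>) has_derivative (*) (- \<alpha>)) (at 0)"
    unfolding has_field_derivative_def[symmetric] by (auto intro!: derivative_eq_intros)
  then obtain d where d: "0 < d" "\<And>y. \<bar>y\<bar> < d \<Longrightarrow> \<bar>(1 - y) powr \<alpha> - 1 + \<alpha> * y\<bar> \<le> \<eta> * \<bar>y\<bar>"
    using \<eta> unfolding has_derivative_at_alt by (fastforce simp: algebra_simps)
  define \<epsilon> where "\<epsilon> = min (1 / 80) (d / 2)"
  have \<epsilon>: "0 < \<epsilon>" "\<epsilon> \<le> 1 / 80" "\<epsilon> < d" using d(1) by (auto simp: \<epsilon>_def min_def)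
  let ?u = "\<lambda>t. (1 - \<epsilon> * exp (- t)) powr \<alpha>"
  have small: "0 < 1 - \<epsilon> * exp (- t)" if "1 \<le> t" for t
  proof -
    have "\<epsilon> * exp (- t) \<le> (1 / 80) * (1 / 2)"
      using \<epsilon> exp_minus_le_half[OF that] by (intro mult_mono) auto
    then show ?thesis by linarith
  qed
  have cont: "continuous_on {1..2} (\<lambda>t. g t * ?u t)"
    unfolding g_def by (intro continuous_intros continuous_on_bump) (use small in fastforce)
  have "integral {1..2} (\<lambda>t. g t * ?u t) \<le> 0 - \<alpha> * \<epsilon> * P + M * \<eta> * \<epsilon>"
  proof (rule has_integral_le)
    show "((\<lambda>t. g t * ?u t) has_integral integral {1..2} (\<lambda>t. g t * ?u t)) {1..2}"
      by (intro integrable_integral integrable_continuous_interval cont)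
    have const: "((\<lambda>_. k) has_integral k) {1..2 :: real}" for k :: real
      using has_integral_const_real[of k 1 2] by simp
    show "((\<lambda>t. g t - \<alpha> * \<epsilon> * (g t * exp (- t)) + M * \<eta> * \<epsilon>) has_integral 0 - \<alpha> * \<epsilon> * P + M * \<eta> * \<epsilon>) {1..2}"
      by (rule has_integral_add[OF has_integral_diff[OF ig has_integral_mult_right[OF igf]] const])
    fix t :: real assume t: "t \<in> {1..2}"
    define y where "y = \<epsilon> * exp (- t)"
    have y: "0 \<le> y" "y \<le> \<epsilon>"
      using \<epsilon> t by (auto simp: y_def intro!: mult_left_le)
    have "\<bar>g t * ((1 - y) powr \<alpha> - 1 + \<alpha> * y)\<bar> \<le> M * (\<eta> * \<epsilon>)"
    proof -
      have "\<bar>(1 - y) powr \<alpha> - 1 + \<alpha> * y\<bar> \<le> \<eta> * \<bar>y\<bar>" using d(2)[of y] y \<epsilon>(3) by simp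
      also have "\<dots> \<le> \<eta> * \<epsilon>" using y \<eta> by simp
      finally show ?thesis unfolding abs_mult using M by (intro mult_mono) auto
    qed
    then show "g t * ?u t \<le> g t - \<alpha> * \<epsilon> * (g t * exp (- t)) + M * \<eta> * \<epsilon>"
      unfolding y_def[symmetric] by (simp add: abs_le_iff y_def algebra_simps)
  qed
  also have "M * \<eta> * \<epsilon> < \<alpha> * P * \<epsilon>"
  proof (intro mult_strict_right_mono \<epsilon>(1))
    have "M * \<eta> = (M / (2 * (M + 1))) * (\<alpha> * P)" by (simp add: \<eta>_def)
    also have "\<dots> < 1 * (\<alpha> * P)"
      using M(1) P assms(1) by (intro mult_strict_right_mono) (auto simp: field_simps)
    finally show "M * \<eta> < \<alpha> * P" by simp
  qed
  finally show ?thesis using that[of \<epsilon>] \<epsilon> by (simp add: g_def algebra_simps)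
qed

text \<open>In the parameter \<open>t\<close> the weight becomes a multiple of
  \<open>(1 - (1 - s) * t) ^ i\<close>, so the integral is a nonnegative multiple of one value of
  the undifferentiated bump.\<close>

lemma has_integral_section_difference:
  assumes s: "0 \<le> s" "s \<le> 1" and c: "0 \<le> c" and N: "i + 2 \<le> N"
  obtains I where "0 \<le> I"
    "((\<lambda>w. (1 - w) ^ i * ((1 / (1 - s * w)) ^ (i + 2) * (c * bump N (i + 1) (1 / (1 - s * w))))) has_integral I) {0..1}"
proof (cases "s = 0")
  case True
  \<comment> \<open>For \<open>s = 0\<close> the parameter is constantly 1, where the bump
    vanishes.\<close>
  have "((\<lambda>w. (1 - w) ^ i * ((1 / (1 - s * w)) ^ (i + 2) * (c * bump N (i + 1) (1 / (1 - s * w))))) has_integral 0) {0..1}"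
    using True N by (intro has_integral_is_0) (simp add: bump_eq_0)
  then show ?thesis using that[of 0] by simp
next
  case False
  then have s0: "0 < s" using s by simp
  define f where "f w = (1 - w) ^ i * ((1 / (1 - s * w)) ^ (i + 2) * (c * bump N (i + 1) (1 / (1 - s * w))))" for w
  \<comment> \<open>For \<open>s \<le> 1 / 2\<close> the parameter ends at
    \<open>1 / (1 - s)\<close>, a zero of \<open>1 - (1 - s) * t\<close>. For larger
    \<open>s\<close> it passes 2, the end of the support of the bump; \<open>b\<close> is the
    corresponding value of \<open>w\<close>.\<close>
  define T where "T = (if s \<le> 1 / 2 then 1 / (1 - s) else 2)"
  define b where "b = (1 - 1 / T) / s"
  have T: "1 \<le> T" using s by (auto simp: T_def field_simps)
  have b: "0 \<le> b" "b \<le> 1" "s \<le> 1 / 2 \<Longrightarrow> b = 1" "1 / 2 < s \<Longrightarrow> b = 1 / (2 * s)"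
    using s s0 by (auto simp: b_def T_def field_simps)
  have lt: "s * w < 1" if "w \<in> {0..b}" for w
  proof -
    have "s * w \<le> s * b" using that s0 by simp
    also have "\<dots> = 1 - 1 / T" using s0 by (simp add: b_def)
    also have "\<dots> < 1" using T by simp
    finally show ?thesis .
  qed
  have bump_cont: "continuous_on A (\<lambda>x. bump N (i + 1) (h x))" if "continuous_on A h" for A and h :: "real \<Rightarrow> real"
    by (rule continuous_on_compose2[OF continuous_on_bump[of UNIV] that]) auto
  have cont: "continuous_on {0..b} f"
    unfolding f_def by (intro continuous_intros bump_cont) (use lt in fastforce)+
  \<comment> \<open>One factor \<open>1 / s\<close> comes from the substitution and \<open>i\<close>
    more from \<open>1 - w = (1 - (1 - s) * t) / (s * t)\<close>; the powers of \<open>t\<close>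
    cancel.\<close>
  define C where "C = c / s ^ (i + 1)"
  have eq: "1 / (s * t\<^sup>2) * f ((1 - 1 / t) / s) = C * (bump N (Suc i) t * (1 - (1 - s) * t) ^ i)" if "t \<in> {1..T}" for t
  proof -
    have t: "t > 0" using that by simp
    have "1 - s * ((1 - 1 / t) / s) = 1 / t" using s0 by simp
    moreover have "1 - (1 - 1 / t) / s = (1 - (1 - s) * t) / (s * t)" using s0 t by (simp add: field_simps)
    ultimately have "1 / (s * t\<^sup>2) * f ((1 - 1 / t) / s)
        = 1 / (s * t\<^sup>2) * (((1 - (1 - s) * t) / (s * t)) ^ i * (t ^ (i + 2) * (c * bump N (Suc i) t)))"
      by (simp add: f_def)
    also have "\<dots> = C * (bump N (Suc i) t * (1 - (1 - s) * t) ^ i)"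
      using s0 t by (simp add: C_def power_divide power_mult_distrib power2_eq_square field_simps)
    finally show ?thesis .
  qed
  have "(\<forall>j<N. bump N j T = 0) \<or> (1 - s) * T = 1"
    using s by (auto simp: T_def bump_eq_0)
  from has_integral_mult_right[OF has_integral_bump_power[OF N T this], of C]
  have "((\<lambda>t. 1 / (s * t\<^sup>2) * f ((1 - 1 / t) / s)) has_integral C * (fact i * (1 - s) ^ i * bump N 0 T)) {1..T}"
    by (rule has_integral_eq[rotated]) (rule eq[symmetric])
  then have "integral {0..b} f = C * (fact i * (1 - s) ^ i * bump N 0 T)"
    using has_integral_unique[OF has_integral_tube_substitution[OF s0 T cont[unfolded b_def]]]
    unfolding b_def by blast
  moreover have "(f has_integral integral {0..b} f) {0..b}"
    by (intro integrable_integral integrable_continuous_interval cont)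
  moreover have "(f has_integral 0) {b..1}"
  proof (cases "s \<le> 1 / 2")
    case True
    then show ?thesis using b(3) has_integral_refl(2)[of f 1] by simp
  next
    case False
    show ?thesis
    proof (rule has_integral_is_0)
      fix w assume w: "w \<in> {b..1}"
      have "1 / 2 = s * b" using b(4) False s0 by simp
      also have "\<dots> \<le> s * w" using w s0 by simp
      finally have "1 / 2 \<le> s * w" .
      moreover have "s * w \<le> 1" using w s b(1) by (intro mult_le_one) auto
      ultimately have "1 / (1 - s * w) \<le> 1 \<or> 2 \<le> 1 / (1 - s * w)"
        by (cases "s * w = 1") (auto simp: field_simps)
      then show "f w = 0" using N by (auto simp: f_def bump_eq_0)
    qed
  qed
  ultimately have "(f has_integral C * (fact i * (1 - s) ^ i * bump N 0 T) + 0) {0..1}"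
    using has_integral_combine[OF b(1,2)] by metis
  moreover have "0 \<le> C * (fact i * (1 - s) ^ i * bump N 0 T)"
    using s s0 c by (simp add: C_def bump_0_nonneg)
  ultimately show ?thesis using that unfolding f_def[abs_def] by simp
qed


lemma section_integral_comparison:
  assumes l: "1 \<le> l"
  obtains \<omega>K \<omega>L where "profile \<omega>K" "profile \<omega>L"
    "\<And>s. 0 \<le> s \<Longrightarrow> s \<le> 1 \<Longrightarrow> section_integral i \<omega>K s \<le> section_integral i \<omega>L s"
    "section_integral (i + l) \<omega>L 1 < section_integral (i + l) \<omega>K 1"
proof -
  define N where "N = i + 4"
  define m where "m = i + 2"
  have m: "1 \<le> m" by (simp add: m_def)
  obtain \<delta> where \<delta>: "0 < \<delta>" "\<And>j t. j < i + 4 \<Longrightarrow> \<bar>\<delta> * bump (i + 4) j t\<bar> \<le> exp (- 2)"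
    "\<And>j t. j < i + 4 \<Longrightarrow> \<bar>\<delta> * bump (i + 4) j t\<bar> \<le> exp (- t)"
    using perturbation_small by metis
  have zero: "\<bar>0 * bump (i + 4) j t\<bar> \<le> exp (- 2)" "\<bar>0 * bump (i + 4) j t\<bar> \<le> exp (- t)" for j t
    by simp_all
  \<comment> \<open>With \<open>n = m + l\<close> this is \<open>n / m - 1\<close>, the exponent in
    the derivative of the power \<open>n / m\<close> that occurs in the volume.\<close>
  define \<alpha> where "\<alpha> = real l / real m"
  have "0 < \<alpha>" using l m by (simp add: \<alpha>_def)
  then obtain \<epsilon> where \<epsilon>: "0 < \<epsilon>" "\<epsilon> \<le> 1 / 80" and
    neg: "integral {1..2} (\<lambda>t. bump N (i + 1) t * (1 - \<epsilon> * exp (- t)) powr \<alpha>) < 0"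
    by (rule integral_bump_powr_neg[of \<alpha> i N]) (simp add: N_def)
  let ?F = "perturbed_exp i"
  define \<omega>K where "\<omega>K = power_profile \<epsilon> m (?F \<delta>)"
  define \<omega>L where "\<omega>L = power_profile \<epsilon> m (?F 0)"
  have K: "profile \<omega>K" unfolding \<omega>K_def by (rule profile_perturbed_exp[OF \<epsilon> m \<delta>(2,3)])
  have L: "profile \<omega>L" unfolding \<omega>L_def by (rule profile_perturbed_exp[OF \<epsilon> m zero])
  \<comment> \<open>The range \<open>v \<ge> 1 / 2\<close> corresponds to \<open>t \<ge> 2\<close>,
    where the two profiles agree; at \<open>v = 1\<close> the convention \<open>1 / 0 = 0\<close>
    still lands outside the bump.\<close>
  have far: "profile_fun \<omega>K v = profile_fun \<omega>L v \<and> bump N (i + 1) (1 / (1 - v)) = 0"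
    if v: "1 / 2 \<le> v" "v \<le> 1" for v
  proof
    show "profile_fun \<omega>K v = profile_fun \<omega>L v"
      unfolding \<omega>K_def \<omega>L_def by (rule profile_fun_power_profile_cong[OF _ v]) (simp add: perturbed_exp_eq)
    have "1 / (1 - v) \<le> 1 \<or> 2 \<le> 1 / (1 - v)"
      using v by (cases "v = 1") (auto simp: field_simps)
    then show "bump N (i + 1) (1 / (1 - v)) = 0" by (auto simp: N_def bump_eq_0)
  qed
  have bdK: "0 \<le> ?F \<delta> t" "?F \<delta> t \<le> 1" if "1 \<le> t" for t
    using that by (auto intro!: perturbed_exp_bounds[of i \<delta>] \<delta>)
  have bdL: "0 \<le> ?F 0 t" "?F 0 t \<le> 1" if "1 \<le> t" for t
    using that by (auto intro!: perturbed_exp_bounds[of i 0])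
  have near: "(1 / profile_fun \<omega>K v) ^ k = (1 / (1 - v)) ^ k / 4 ^ k * (1 - \<epsilon> * ?F \<delta> (1 / (1 - v))) powr (k / m)"
      "(1 / profile_fun \<omega>L v) ^ k = (1 / (1 - v)) ^ k / 4 ^ k * (1 - \<epsilon> * ?F 0 (1 / (1 - v))) powr (k / m)"
    if v: "0 \<le> v" "v \<le> 1 / 2" for v k
  proof -
    have t: "1 \<le> 1 / (1 - v)" using v by (simp add: field_simps)
    show "(1 / profile_fun \<omega>K v) ^ k = (1 / (1 - v)) ^ k / 4 ^ k * (1 - \<epsilon> * ?F \<delta> (1 / (1 - v))) powr (k / m)"
      unfolding \<omega>K_def
      by (rule profile_fun_power_profile[where F = "?F \<delta>", OF \<epsilon> v bdK[OF t] m])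
    show "(1 / profile_fun \<omega>L v) ^ k = (1 / (1 - v)) ^ k / 4 ^ k * (1 - \<epsilon> * ?F 0 (1 / (1 - v))) powr (k / m)"
      unfolding \<omega>L_def
      by (rule profile_fun_power_profile[where F = "?F 0", OF \<epsilon> v bdL[OF t] m])
  qed
  have pos: "0 < 1 - \<epsilon> * ?F \<delta> t" "0 < 1 - \<epsilon> * ?F 0 t" if "1 \<le> t" for t
  proof -
    have "\<epsilon> * ?F \<delta> t \<le> (1 / 80) * 1" "\<epsilon> * ?F 0 t \<le> (1 / 80) * 1"
      using \<epsilon> bdK[OF that] bdL[OF that]
      by (intro mult_mono; simp)+
    then show "0 < 1 - \<epsilon> * ?F \<delta> t" "0 < 1 - \<epsilon> * ?F 0 t" by linarith+
  qed
  have diff: "?F \<delta> t - ?F 0 t = \<delta> * bump N (i + 1) t" for t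
    by (simp add: perturbed_exp_def N_def)
  have sections: "section_integral i \<omega>K s \<le> section_integral i \<omega>L s" if s: "0 \<le> s" "s \<le> 1" for s
  proof -
    define c where "c = \<epsilon> * \<delta> / 4 ^ (i + 2)"
    have "0 \<le> c" "i + 2 \<le> N" using \<epsilon> \<delta> by (simp_all add: c_def N_def)
    then obtain I where I: "0 \<le> I"
      "((\<lambda>w. (1 - w) ^ i * ((1 / (1 - s * w)) ^ (i + 2) * (c * bump N (i + 1) (1 / (1 - s * w))))) has_integral I) {0..1}"
      by (rule has_integral_section_difference[OF s])
    \<comment> \<open>For the exponent \<open>m\<close> the real power is the first power, so the
      difference is exactly linear in the bump.\<close>
    have pw: "(1 / profile_fun \<omega>L v) ^ (i + 2) - (1 / profile_fun \<omega>K v) ^ (i + 2)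
        = (1 / (1 - v)) ^ (i + 2) * (c * bump N (i + 1) (1 / (1 - v)))" if v: "0 \<le> v" "v \<le> 1" for v
    proof (cases "v \<le> 1 / 2")
      case True
      have t: "1 \<le> 1 / (1 - v)" using v True by (simp add: field_simps)
      have one: "real (i + 2) / real m = 1" by (simp add: m_def)
      have "(1 / profile_fun \<omega>L v) ^ (i + 2) - (1 / profile_fun \<omega>K v) ^ (i + 2)
          = (1 / (1 - v)) ^ (i + 2) / 4 ^ (i + 2) * (\<epsilon> * (?F \<delta> (1 / (1 - v)) - ?F 0 (1 / (1 - v))))"
      proof -
        have "A * (1 - \<epsilon> * a) - A * (1 - \<epsilon> * b) = A * (\<epsilon> * (b - a))" for A a b :: real
          by (simp add: algebra_simps)
        then show ?thesis
          unfolding near[OF v(1) True] one pos[OF t, THEN less_imp_le, THEN powr_one] .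
      qed
      then show ?thesis unfolding diff c_def by simp
    next
      case False
      then show ?thesis using far[of v] v by simp
    qed
    have "section_integral i \<omega>L s - section_integral i \<omega>K s = I"
    proof (rule has_integral_unique[OF section_integral_diff[OF L K s, of i]])
      show "((\<lambda>w. (1 - w) ^ i * ((1 / profile_fun \<omega>L (s * w)) ^ (i + 2) - (1 / profile_fun \<omega>K (s * w)) ^ (i + 2)))
          has_integral I) {0..1}"
      proof (rule has_integral_eq[OF _ I(2)])
        fix w :: real assume "w \<in> {0..1}"
        then have "0 \<le> s * w" "s * w \<le> 1" using s by (auto intro: mult_le_one)
        then show "(1 - w) ^ i * ((1 / (1 - s * w)) ^ (i + 2) * (c * bump N (i + 1) (1 / (1 - s * w))))
            = (1 - w) ^ i * ((1 / profile_fun \<omega>L (s * w)) ^ (i + 2) - (1 / profile_fun \<omega>K (s * w)) ^ (i + 2))"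
          using pw by presburger
      qed
    qed
    then show ?thesis using I(1) by linarith
  qed
  have volume: "section_integral (i + l) \<omega>L 1 < section_integral (i + l) \<omega>K 1"
  proof -
    define n where "n = i + l + 2"
    define q where "q = real n / real m"
    have q: "1 \<le> q" "q - 1 = \<alpha>" using m by (simp_all add: q_def \<alpha>_def n_def m_def field_simps)
    define C where "C = q * \<epsilon> * \<delta> / 4 ^ n"
    have C: "0 < C" using q \<epsilon> \<delta> by (simp add: C_def)
    define g where "g t = bump N (i + 1) t * (1 - \<epsilon> * exp (- t)) powr \<alpha>" for t
    \<comment> \<open>The tangent bound makes \<open>h\<close> a minorant of the volume integrand of
      \<open>K\<close> minus that of \<open>L\<close>, with a positive integral.\<close>
    define h where "h w = (1 - w) ^ (i + l) * ((1 / (1 - w)) ^ n * (- C * g (1 / (1 - w))))" for w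
    have cont_g: "continuous_on {1..2} g"
      unfolding g_def using pos(2)
      by (intro continuous_intros continuous_on_bump) (fastforce simp: perturbed_exp_0)
    have cont_h: "continuous_on {0..1 / 2} h"
      unfolding h_def
      by (intro continuous_intros continuous_on_compose2[OF cont_g]) (auto simp: field_simps)
    have sub: "((\<lambda>t. 1 / (1 * t\<^sup>2) * h ((1 - 1 / t) / 1)) has_integral integral {0..(1 - 1 / 2) / 1} h) {1..2}"
      by (rule has_integral_tube_substitution) (use cont_h in auto)
    have "((\<lambda>t. - C * g t) has_integral integral {0..(1 - 1 / 2) / 1} h) {1..2}"
    proof (rule has_integral_eq[OF _ sub])
      fix t :: real assume "t \<in> {1..2}"
      then have t: "t > 0" by simp
      \<comment> \<open>At \<open>s = 1\<close> the weight times \<open>t ^ n\<close> is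
        \<open>t\<^sup>2\<close>, which the Jacobian cancels.\<close>
      have "h (1 - 1 / t) = (1 / t) ^ (i + l) * (t ^ n * (- C * g t))" by (simp add: h_def)
      also have "\<dots> = t\<^sup>2 * (- C * g t)"
        using t by (simp add: n_def power_add power_divide power2_eq_square)
      finally show "1 / (1 * t\<^sup>2) * h ((1 - 1 / t) / 1) = - C * g t" using t by simp
    qed
    then have "((\<lambda>t. - C * g t) has_integral integral {0..1 / 2} h) {1..2}" by simp
    moreover have "((\<lambda>t. - C * g t) has_integral - C * integral {1..2} g) {1..2}"
      by (intro has_integral_mult_right integrable_integral integrable_continuous_interval cont_g)
    ultimately have "integral {0..1 / 2} h = - C * integral {1..2} g" by (rule has_integral_unique)
    then have "0 < integral {0..1 / 2} h" using C neg by (simp add: g_def[abs_def] mult_less_0_iff)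
    have "(h has_integral integral {0..1 / 2} h) {0..1 / 2}"
      by (intro integrable_integral integrable_continuous_interval cont_h)
    moreover have "(h has_integral 0) {1 / 2..1}"
      by (rule has_integral_is_0) (use far in \<open>auto simp: h_def g_def\<close>)
    ultimately have int_h: "(h has_integral integral {0..1 / 2} h + 0) {0..1}"
      by (intro has_integral_combine[of 0 "1 / 2" 1]) auto
    have "integral {0..1 / 2} h + 0 \<le> section_integral (i + l) \<omega>K 1 - section_integral (i + l) \<omega>L 1"
    proof (rule has_integral_le[OF int_h section_integral_diff[OF K L, of 1 "i + l"]])
      fix w :: real assume w: "w \<in> {0..1}"
      show "h w \<le> (1 - w) ^ (i + l) * ((1 / profile_fun \<omega>K (1 * w)) ^ (i + l + 2)
          - (1 / profile_fun \<omega>L (1 * w)) ^ (i + l + 2))"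
      proof (cases "w \<le> 1 / 2")
        case True
        define t where "t = 1 / (1 - w)"
        have t: "1 \<le> t" using w True by (simp add: t_def field_simps)
        \<comment> \<open>The function \<open>x powr q\<close> with \<open>q \<ge> 1\<close> lies
          above its tangent at the value belonging to \<open>L\<close>.\<close>
        have "q * (1 - \<epsilon> * ?F 0 t) powr (q - 1) * ((1 - \<epsilon> * ?F \<delta> t) - (1 - \<epsilon> * ?F 0 t))
            \<le> (1 - \<epsilon> * ?F \<delta> t) powr q - (1 - \<epsilon> * ?F 0 t) powr q"
          using powr_above_tangent[OF pos(2)[OF t] pos(1)[OF t], of q] q by simp
        also have "(1 - \<epsilon> * ?F \<delta> t) - (1 - \<epsilon> * ?F 0 t) = - (\<epsilon> * \<delta> * bump N (i + 1) t)"
          using diff[of t] by (simp add: algebra_simps)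
        finally have "t ^ n / 4 ^ n * (q * (1 - \<epsilon> * ?F 0 t) powr \<alpha> * - (\<epsilon> * \<delta> * bump N (i + 1) t))
            \<le> t ^ n / 4 ^ n * ((1 - \<epsilon> * ?F \<delta> t) powr q - (1 - \<epsilon> * ?F 0 t) powr q)"
          unfolding q(2) using t by (intro mult_left_mono) auto
        also have "t ^ n / 4 ^ n * (q * (1 - \<epsilon> * ?F 0 t) powr \<alpha> * - (\<epsilon> * \<delta> * bump N (i + 1) t))
            = t ^ n * (- C * g t)"
          by (simp add: C_def g_def perturbed_exp_0)
        also have "t ^ n / 4 ^ n * ((1 - \<epsilon> * ?F \<delta> t) powr q - (1 - \<epsilon> * ?F 0 t) powr q)
            = (1 / profile_fun \<omega>K w) ^ n - (1 / profile_fun \<omega>L w) ^ n"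
          using near[of w n] w True unfolding t_def q_def by (simp add: right_diff_distrib)
        finally show ?thesis
          using w unfolding h_def t_def n_def by (intro mult_left_mono) auto
      next
        case False
        then show ?thesis using far[of w] w by (simp add: h_def g_def)
      qed
    qed simp_all
    then show ?thesis using \<open>0 < integral {0..1 / 2} h\<close> by linarith
  qed
  show ?thesis using that[OF K L sections volume] .
qed

theorem theorem5:
  fixes l :: nat
  assumes "1 \<le> l" and "l + 2 \<le> CARD('n::finite)"
  shows "\<exists>K L :: (complex ^ 'n) set.
           body K \<and> R_theta_invariant K \<and> h_convex K \<and>
           body L \<and> R_theta_invariant L \<and> h_convex L \<and>
           (\<forall>H. vec.subspace H \<and> vec.dim H = CARD('n) - l \<longrightarrow> hvol H K \<le> hvol H L) \<and>
           hvol UNIV K > hvol UNIV L"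
proof -
  \<comment> \<open>The sections have complex dimension \<open>j + 2\<close>; the assumption on
    \<open>l\<close> makes this at least 2, as the sphere formula requires.\<close>
  define j where "j = CARD('n) - l - 2"
  have j: "CARD('n) - l = j + 2" "CARD('n) = (j + l) + 2" using assms by (simp_all add: j_def)
  obtain \<omega>K \<omega>L where \<omega>: "profile \<omega>K" "profile \<omega>L"
    and sections: "\<And>s. 0 \<le> s \<Longrightarrow> s \<le> 1 \<Longrightarrow> section_integral j \<omega>K s \<le> section_integral j \<omega>L s"
    and volume: "section_integral (j + l) \<omega>L 1 < section_integral (j + l) \<omega>K 1"
    using section_integral_comparison[OF assms(1)] by metis
  define i :: 'n where "i = undefined"
  define K where "K = profile_body i \<omega>K"
  define L where "L = profile_body i \<omega>L"
  have "hvol H K \<le> hvol H L" if H: "vec.subspace H" "vec.dim H = CARD('n) - l" for H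
  proof -
    obtain s where "0 \<le> s" "s \<le> 1" "\<And>\<omega>. profile \<omega> \<Longrightarrow> hvol H (profile_body i \<omega>)
        = section_constant j * section_integral j \<omega> s"
      using hvol_profile_body[OF H(1), of j i] H(2) j(1) by metis
    then show ?thesis
      using \<omega> sections section_constant_pos[of j] by (simp add: K_def L_def mult_left_mono)
  qed
  moreover have "hvol UNIV L < hvol UNIV K"
  proof -
    have "vec.dim (UNIV :: (complex ^ 'n) set) = (j + l) + 2" using j(2) by (simp add: vec.dim_UNIV card_cart_basis)
    then obtain s where "(UNIV :: (complex ^ 'n) set) = UNIV \<Longrightarrow> s = 1"
      "\<And>\<omega>. profile \<omega> \<Longrightarrow> hvol UNIV (profile_body i \<omega>)
        = section_constant (j + l) * section_integral (j + l) \<omega> s"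
      using hvol_profile_body[OF vec.subspace_UNIV, of "j + l" i] by metis
    then show ?thesis
      using \<omega> volume section_constant_pos[of "j + l"] by (simp add: K_def L_def)
  qed
  moreover have "body K" "body L" "h_convex K" "h_convex L" "R_theta_invariant K" "R_theta_invariant L"
    unfolding K_def L_def
    by (simp_all add: \<omega> body_profile_body h_convex_profile_body R_theta_invariant_profile_body)
  ultimately show ?thesis by blast
qed

end
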